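(* Let $\alpha,\beta>0$. For $f\in L^1(\mathbb{R}^2,\mathbb{H})$ consider the following two conditions, required for some constants $C>0$ and $C'>0$: (i) $|f(\mathbf{x})|_Q< C\,e^{-\alpha|\mathbf{x}|^2}$ for $\mathbf{x}\in\mathbb{R}^2$; (ii) $|\mathcal{F}\{f\}(\mathbf{y})|_Q< C'\,e^{-\beta|\mathbf{y}|^2}$ for $\mathbf{y}\in\mathbb{R}^2$. Then: 1. If $\alpha\beta>\pi^2$, every $f\in L^1(\mathbb{R}^2,\mathbb{H})$ satisfying (i) and (ii) is $0$ almost everywhere on $\mathbb{R}^2$. 2. If $\alpha\beta=\pi^2$, every $f\in L^1(\mathbb{R}^2,\mathbb{H})$ satisfying (i) and (ii) is (almost everywhere) a constant quaternion multiple of $e^{-\alpha|\mathbf{x}|^2}$. 3. If $\alpha\beta<\pi^2$, there are infinitely many linearly independent functions satisfying both (i) and (ii).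
   Context: $\mathbb{H}$ denotes the algebra of real quaternions $q=q_0+\mathbf{i}q_1+\mathbf{j}q_2+\mathbf{k}q_3$ ($q_m\in\mathbb{R}$), with $\mathbf{i}^2=\mathbf{j}^2=\mathbf{k}^2=-1$, $\mathbf{i}\mathbf{j}=-\mathbf{j}\mathbf{i}=\mathbf{k}$, $\mathbf{j}\mathbf{k}=-\mathbf{k}\mathbf{j}=\mathbf{i}$, $\mathbf{k}\mathbf{i}=-\mathbf{i}\mathbf{k}=\mathbf{j}$, and modulus $|q|_Q=\sqrt{q_0^2+q_1^2+q_2^2+q_3^2}$. For $\mathbf{x}=(x_1,x_2)\in\mathbb{R}^2$, $|\mathbf{x}|=\sqrt{x_1^2+x_2^2}$, and $d\mathbf{x}$ is Lebesgue measure on $\mathbb{R}^2$. $L^1(\mathbb{R}^2,\mathbb{H})$ is the space of measurable $f:\mathbb{R}^2\to\mathbb{H}$ with $\int_{\mathbb{R}^2}|f(\mathbf{x})|_Q\,d\mathbf{x}<\infty$. The two-sided quaternion Fourier transform of $f\in L^1(\mathbb{R}^2,\mathbb{H})$ is $$\mathcal{F}\{f\}(\boldsymbol{\xi})=\int_{\mathbb{R}^2}e^{-\mathbf{i}2\pi\xi_1x_1}\,f(\mathbf{x})\,e^{-\mathbf{j}2\pi\xi_2x_2}\,d\mathbf{x},\qquad \boldsymbol{\xi}=(\xi_1,\xi_2)\in\mathbb{R}^2 .$$ *)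

theory Defs
  imports "HOL-Analysis.Analysis"
begin

datatype quat = Quat (qRe: real) (qI: real) (qJ: real) (qK: real)

lemma quat_eq_iff: "p = q \<longleftrightarrow> qRe p = qRe q \<and> qI p = qI q \<and> qJ p = qJ q \<and> qK p = qK q"
  using quat.expand by auto

instantiation quat :: ring_1
begin

definition "0 = Quat 0 0 0 0"
definition "1 = Quat 1 0 0 0"
definition "- p = Quat (- qRe p) (- qI p) (- qJ p) (- qK p)"
definition "p + q = Quat (qRe p + qRe q) (qI p + qI q) (qJ p + qJ q) (qK p + qK q)"
definition "p - q = Quat (qRe p - qRe q) (qI p - qI q) (qJ p - qJ q) (qK p - qK q)"
definition "p * q = Quat
  (qRe p * qRe q - qI p * qI q - qJ p * qJ q - qK p * qK q)
  (qRe p * qI q + qI p * qRe q + qJ p * qK q - qK p * qJ q)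
  (qRe p * qJ q - qI p * qK q + qJ p * qRe q + qK p * qI q)
  (qRe p * qK q + qI p * qJ q - qJ p * qI q + qK p * qRe q)"

instance
proof
  fix p q r :: quat
  show "p + q + r = p + (q + r)"
    and "p + q = q + p"
    and "0 + p = p"
    and "- p + p = 0"
    and "p - q = p + - q"
    and "1 * p = p"
    and "p * 1 = p"
    and "(0 :: quat) \<noteq> 1"
    by (simp_all add: quat_eq_iff zero_quat_def one_quat_def uminus_quat_def plus_quat_def
        minus_quat_def times_quat_def)
  show "p * q * r = p * (q * r)"
    and "(p + q) * r = p * r + q * r"
    and "p * (q + r) = p * q + p * r"
    by (simp_all add: quat_eq_iff plus_quat_def times_quat_def algebra_simps)
qed

end

definition quat_i :: quat where "quat_i = Quat 0 1 0 0"
definition quat_j :: quat where "quat_j = Quat 0 0 1 0"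
definition quat_k :: quat where "quat_k = Quat 0 0 0 1"

lemma quat_units_mult:
  "quat_i * quat_i = -1" "quat_j * quat_j = -1" "quat_k * quat_k = -1"
  "quat_i * quat_j = quat_k" "quat_j * quat_i = - quat_k"
  "quat_j * quat_k = quat_i" "quat_k * quat_j = - quat_i"
  "quat_k * quat_i = quat_j" "quat_i * quat_k = - quat_j"
  by (simp_all add: quat_i_def quat_j_def quat_k_def times_quat_def uminus_quat_def one_quat_def)

instantiation quat :: real_inner
begin

definition "r *\<^sub>R q = Quat (r * qRe q) (r * qI q) (r * qJ q) (r * qK q)"
definition "inner p q = qRe p * qRe q + qI p * qI q + qJ p * qJ q + qK p * qK q"
definition "norm q = sqrt ((qRe q)\<^sup>2 + (qI q)\<^sup>2 + (qJ q)\<^sup>2 + (qK q)\<^sup>2)" for q :: quat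
definition "sgn q = inverse (norm q) *\<^sub>R q" for q :: quat
definition "dist p q = norm (p - q)" for p q :: quat
definition "(uniformity :: (quat \<times> quat) filter) =
  (INF e\<in>{0 <..}. principal {(p, q). dist p q < e})"
definition "open U \<longleftrightarrow>
  (\<forall>p\<in>U. eventually (\<lambda>(p', q). p' = p \<longrightarrow> q \<in> U) uniformity)" for U :: "quat set"

instance
proof
  fix p q r :: quat and a b :: real
  show "a *\<^sub>R (p + q) = a *\<^sub>R p + a *\<^sub>R q"
    and "(a + b) *\<^sub>R p = a *\<^sub>R p + b *\<^sub>R p"
    and "a *\<^sub>R b *\<^sub>R p = (a * b) *\<^sub>R p"
    and "1 *\<^sub>R p = p"
    by (simp_all add: quat_eq_iff scaleR_quat_def plus_quat_def algebra_simps)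
  show "dist p q = norm (p - q)"
    and "sgn p = inverse (norm p) *\<^sub>R p"
    by (simp_all add: dist_quat_def sgn_quat_def)
  show "inner p q = inner q p"
    and "inner (p + q) r = inner p r + inner q r"
    and "inner (a *\<^sub>R p) q = a * inner p q"
    and "0 \<le> inner p p"
    by (simp_all add: inner_quat_def scaleR_quat_def plus_quat_def algebra_simps)
  show "inner p p = 0 \<longleftrightarrow> p = 0"
    unfolding inner_quat_def quat_eq_iff zero_quat_def
    by (simp add: add_nonneg_eq_0_iff)
  show "norm p = sqrt (inner p p)"
    by (simp add: norm_quat_def inner_quat_def power2_eq_square)
qed (simp_all only: uniformity_quat_def open_quat_def)

end

instance quat :: real_normed_algebra_1
proof
  fix p q :: quat and a :: real
  show "a *\<^sub>R p * q = a *\<^sub>R (p * q)"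
    and "p * a *\<^sub>R q = a *\<^sub>R (p * q)"
    by (simp_all add: quat_eq_iff scaleR_quat_def times_quat_def algebra_simps)
  have four_squares: "(a * e - b * f - c * g - d * h)\<^sup>2 + (a * f + b * e + c * h - d * g)\<^sup>2 +
      (a * g - b * h + c * e + d * f)\<^sup>2 + (a * h + b * g - c * f + d * e)\<^sup>2 =
      (a\<^sup>2 + b\<^sup>2 + c\<^sup>2 + d\<^sup>2) * (e\<^sup>2 + f\<^sup>2 + g\<^sup>2 + h\<^sup>2)" for a b c d e f g h :: real
    by algebra
  have "norm (p * q) = norm p * norm q"
    by (simp only: norm_quat_def times_quat_def quat.sel four_squares real_sqrt_mult)
  then show "norm (p * q) \<le> norm p * norm q"
    by simp
  show "norm (1 :: quat) = 1"
    by (simp add: norm_quat_def one_quat_def)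
qed

instantiation quat :: euclidean_space
begin

definition "Basis = {1, quat_i, quat_j, quat_k}"

instance
proof
  show "(Basis :: quat set) \<noteq> {}" and "finite (Basis :: quat set)"
    by (simp_all add: Basis_quat_def)
next
  fix u v :: quat
  assume "u \<in> Basis" "v \<in> Basis"
  then show "inner u v = (if u = v then 1 else 0)"
    unfolding Basis_quat_def one_quat_def quat_i_def quat_j_def quat_k_def insert_iff empty_iff
    by (elim disjE) (simp_all add: inner_quat_def)
next
  fix q :: quat
  show "(\<forall>u\<in>Basis. inner q u = 0) \<longleftrightarrow> q = 0"
    unfolding Basis_quat_def one_quat_def quat_i_def quat_j_def quat_k_def quat_eq_iff
    by (simp add: inner_quat_def zero_quat_def)
qed

end

definition qft :: "(real^2 \<Rightarrow> quat) \<Rightarrow> real^2 \<Rightarrow> quat" where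
  "qft f \<xi> = (\<integral>x. exp (- (quat_i * of_real (2 * pi * \<xi>$1 * x$1))) * f x *
                  exp (- (quat_j * of_real (2 * pi * \<xi>$2 * x$2))) \<partial>lebesgue)"

definition gauss_bounded :: "real \<Rightarrow> (real^2 \<Rightarrow> quat) \<Rightarrow> bool" where
  "gauss_bounded \<gamma> g \<longleftrightarrow> (\<exists>C>0. \<forall>x. norm (g x) < C * exp (- \<gamma> * (norm x)\<^sup>2))"

text \<open>Functions are compared as elements of \<open>L\<^sup>1\<close>, that is, up to null sets. \<open>L\<^sup>1\<close> is both
  a left and a right module over the quaternions; independence is required for both structures
  (each of them implies independence over the reals).\<close>

definition left_independent :: "(real^2 \<Rightarrow> quat) set \<Rightarrow> bool" where
  "left_independent S \<longleftrightarrow>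
    (\<forall>T c. finite T \<and> T \<subseteq> S \<and> (AE x in lebesgue. (\<Sum>g\<in>T. c g * g x) = 0)
      \<longrightarrow> (\<forall>g\<in>T. c g = 0))"

definition right_independent :: "(real^2 \<Rightarrow> quat) set \<Rightarrow> bool" where
  "right_independent S \<longleftrightarrow>
    (\<forall>T c. finite T \<and> T \<subseteq> S \<and> (AE x in lebesgue. (\<Sum>g\<in>T. g x * c g) = 0)
      \<longrightarrow> (\<forall>g\<in>T. c g = 0))"

end

(*
The map p -> p + s i p j with s = 1 or s = -1 splits the quaternions into two complex lines on
which right multiplication by j equals -s times left multiplication by i.  On such a line the
two-sided kernel is the scalar exp (i (s b - a)), so the quaternion transform becomes, up to a
reflection of one frequency, two classical Fourier transforms.

The classical theorem at the critical exponent holds in any dimension: restricted to a line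
through the origin, the transform is an entire function of order two, and after division by the
Gaussian it is constant by a Phragmen-Lindelof argument.  Hence the transform is a Gaussian, and
so is the function, by injectivity of the Fourier transform; the latter is reduced to Levy's
uniqueness theorem for one coordinate at a time.

Above the critical exponent, a function is critical for two different exponents at once and
must vanish.  Below it, the Gaussians with exponent strictly between alpha and pi^2 / beta
satisfy both bounds, and they are independent because of their different decay rates.
*)
theory Submission
  imports
    Defs
    "HOL-Complex_Analysis.Conformal_Mappings"
    "HOL-Probability.Levy"
    "HOL-Real_Asymp.Real_Asymp"
begin

section \<open>A Phragmen--Lindelof theorem of order two\<close>

text \<open>In the logarithmic coordinate \<open>w = ln z\<close> a sector is a strip, so the maximum principle is applied
  on rectangles. The bound degenerates to a constant when \<open>\<psi>\<close> tends to \<open>pi / 2\<close>.\<close>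

lemma gaussian_growth_sector_bound:
  fixes h :: "complex \<Rightarrow> complex" and C \<beta> \<psi> s0 \<phi>0 :: real
  assumes hol: "h holomorphic_on UNIV" and \<beta>: "\<beta> > 0" and C: "C \<ge> 0"
    and growth: "\<And>z. norm (h z) \<le> C * exp (\<beta> * (Re z)\<^sup>2)"
    and real_bound: "\<And>x. norm (h (of_real x)) \<le> C"
    and \<psi>: "0 < \<psi>" "\<psi> < pi / 2"
    and w0: "0 \<le> s0" "0 \<le> \<phi>0" "\<phi>0 \<le> \<psi>"
  shows "norm (h (exp (Complex s0 \<phi>0)))
    \<le> C * exp \<beta> * exp (\<beta> * cos \<psi> / (2 * sin \<psi>) * exp (2 * s0) * sin (2 * \<phi>0))"
proof -
  \<comment> \<open>\<open>p\<close> is the midpoint of 2 and \<open>pi / \<psi>\<close>: larger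
    than 2, to beat the order of \<open>h\<close>, yet small enough to keep
    \<open>cos (p * (\<phi> - \<psi> / 2))\<close> positive across the sector.\<close>
  define p where "p = 1 + pi / (2 * \<psi>)"
  define A where "A = \<beta> * cos \<psi> / (2 * sin \<psi>)"
  define \<delta> where "\<delta> = cos (p * \<psi> / 2)"
  have sc: "sin \<psi> > 0" "cos \<psi> > 0"
    using \<psi> by (auto intro!: sin_gt_zero cos_gt_zero_pi)
  have A: "A > 0" using sc \<beta> by (simp add: A_def)
  have A\<psi>: "A * sin (2 * \<psi>) = \<beta> * (cos \<psi>)\<^sup>2"
    using sc by (simp add: A_def sin_double power2_eq_square)
  have p: "p > 2" using \<psi> by (simp add: p_def field_simps)
  have p\<psi>: "p * \<psi> / 2 = \<psi> / 2 + pi / 4"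
    using \<psi> by (simp add: p_def field_simps)
  have \<delta>: "\<delta> > 0"
    unfolding \<delta>_def p\<psi> using \<psi> by (intro cos_gt_zero_pi) auto
  define K where "K = C * exp \<beta>"
  have CK: "C \<le> K" using C \<beta> mult_left_mono[of 1 "exp \<beta>" C] by (simp add: K_def)
  \<comment> \<open>The second factor balances the growth of \<open>h\<close> on the ray \<open>arg z = \<psi>\<close>. The third one, of order \<open>p > 2\<close>
    and available because \<open>\<psi> < pi / 2\<close>, makes the far edge harmless and disappears as \<open>\<epsilon> \<rightarrow> 0\<close>.\<close>
  define H where "H = (\<lambda>\<epsilon>::real. \<lambda>w. h (exp w) * exp (\<i> * of_real A * exp (2 * w))
      * exp (- of_real \<epsilon> * exp (of_real p * (w - \<i> * of_real (\<psi> / 2)))))"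
  have normH: "norm (H \<epsilon> (Complex s \<phi>)) = norm (h (exp (Complex s \<phi>)))
      * exp (- A * exp (2 * s) * sin (2 * \<phi>)) * exp (- \<epsilon> * exp (p * s) * cos (p * (\<phi> - \<psi> / 2)))"
    for \<epsilon> s \<phi>
    by (simp add: H_def norm_mult Re_exp Im_exp mult.assoc)
  have bound: "norm (H \<epsilon> (Complex s0 \<phi>0)) \<le> K" if \<epsilon>: "\<epsilon> > 0" for \<epsilon>
  proof -
    have "eventually (\<lambda>R. \<beta> * exp (2 * R) \<le> \<epsilon> * \<delta> * exp (p * R)) at_top"
      using \<beta> \<epsilon> \<delta> p by real_asymp
    then have "eventually (\<lambda>R. \<beta> * exp (2 * R) \<le> \<epsilon> * \<delta> * exp (p * R) \<and> R > s0) at_top"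
      by (intro eventually_conj eventually_gt_at_top)
    then obtain R where R: "\<beta> * exp (2 * R) \<le> \<epsilon> * \<delta> * exp (p * R)" "R > s0"
      by (auto simp: eventually_at_top_linorder)
    have cos_ge: "cos (p * (\<phi> - \<psi> / 2)) \<ge> \<delta>" if "0 \<le> \<phi>" "\<phi> \<le> \<psi>" for \<phi>
    proof -
      have "\<bar>p * (\<phi> - \<psi> / 2)\<bar> \<le> p * \<psi> / 2"
      proof -
        have "\<bar>\<phi> - \<psi> / 2\<bar> \<le> \<psi> / 2" using that by linarith
        then have "p * \<bar>\<phi> - \<psi> / 2\<bar> \<le> p * (\<psi> / 2)" using p by (intro mult_left_mono) auto
        then show ?thesis using p by (simp add: abs_mult)
      qed
      then have "cos (p * \<psi> / 2) \<le> cos \<bar>p * (\<phi> - \<psi> / 2)\<bar>"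
        using \<psi> unfolding p\<psi> by (intro cos_monotone_0_pi_le) auto
      then show ?thesis by (simp add: \<delta>_def)
    qed
    have edge: "norm (H \<epsilon> (Complex s \<phi>)) \<le> K"
      if s: "0 \<le> s" "s \<le> R" and \<phi>: "0 \<le> \<phi>" "\<phi> \<le> \<psi>"
        and e: "s = 0 \<or> s = R \<or> \<phi> = 0 \<or> \<phi> = \<psi>" for s \<phi>
    proof -
      have s2: "sin (2 * \<phi>) \<ge> 0" using \<phi> \<psi> by (intro sin_ge_zero) auto
      have cs: "cos (p * (\<phi> - \<psi> / 2)) \<ge> \<delta>" using cos_ge \<phi> by simp
      have e1: "exp (- A * exp (2 * s) * sin (2 * \<phi>)) \<le> 1"
        using A s2 by simp
      have e2: "exp (- \<epsilon> * exp (p * s) * cos (p * (\<phi> - \<psi> / 2))) \<le> exp (- \<epsilon> * \<delta> * exp (p * s))"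
        using \<epsilon> cs by (simp add: mult.assoc mult.commute[of "exp _"])
      have e3: "exp (- \<epsilon> * \<delta> * exp (p * s)) \<le> 1" using \<epsilon> \<delta> by simp
      have g: "norm (h (exp (Complex s \<phi>))) \<le> C * exp (\<beta> * exp (2 * s) * (cos \<phi>)\<^sup>2)"
        using growth[of "exp (Complex s \<phi>)"]
        unfolding exp_double by (simp add: Re_exp power_mult_distrib mult_ac)
      have c1: "(cos \<phi>)\<^sup>2 \<le> 1" by (simp add: abs_square_le_1)
      \<comment> \<open>In terms of \<open>z = exp w\<close>, the edges are the positive real axis,
        the ray \<open>arg z = \<psi>\<close>, the unit arc and the arc of radius
        \<open>exp R\<close>.\<close>
      consider "\<phi> = 0" | "\<phi> = \<psi>" | "s = 0" | "s = R" using e by blast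
      then show ?thesis
      proof cases
        case 1
        have "norm (h (exp (Complex s \<phi>))) \<le> C"
          using real_bound[of "exp s"] 1 by (simp add: exp_of_real[symmetric] Complex_eq)
        then have "norm (H \<epsilon> (Complex s \<phi>)) \<le> C * 1 * 1"
          unfolding normH using e1 e2 e3 C by (intro mult_mono) auto
        then show ?thesis using CK by simp
      next
        case 2
        have "norm (H \<epsilon> (Complex s \<phi>)) \<le>
            C * exp (\<beta> * exp (2 * s) * (cos \<phi>)\<^sup>2) * exp (- A * exp (2 * s) * sin (2 * \<phi>)) * 1"
          unfolding normH using e1 e2 e3 C g by (intro mult_mono) auto
        also have "\<dots> = C * exp (exp (2 * s) * (\<beta> * (cos \<psi>)\<^sup>2 - A * sin (2 * \<psi>)))"
        proof -
          have "exp (2 * s) * (\<beta> * (cos \<psi>)\<^sup>2 - A * sin (2 * \<psi>)) =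
              \<beta> * exp (2 * s) * (cos \<phi>)\<^sup>2 + - A * exp (2 * s) * sin (2 * \<phi>)"
            by (simp add: 2 algebra_simps)
          then show ?thesis by (simp only: exp_add mult.assoc mult_1_right)
        qed
        also have "\<dots> = C" by (simp add: A\<psi>)
        finally show ?thesis using CK by simp
      next
        case 3
        have "norm (H \<epsilon> (Complex s \<phi>)) \<le> C * exp (\<beta> * exp (2 * s) * (cos \<phi>)\<^sup>2) * 1 * 1"
          unfolding normH using e1 e2 e3 C g by (intro mult_mono) auto
        also have "\<dots> \<le> K" using 3 C \<beta> c1 by (simp add: K_def mult_left_mono)
        finally show ?thesis .
      next
        case 4
        have "norm (H \<epsilon> (Complex s \<phi>)) \<le>
            C * exp (\<beta> * exp (2 * s) * (cos \<phi>)\<^sup>2) * 1 * exp (- \<epsilon> * \<delta> * exp (p * s))"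
          unfolding normH using e1 e2 C g by (intro mult_mono) auto
        also have "\<dots> = C * exp (\<beta> * exp (2 * s) * (cos \<phi>)\<^sup>2 - \<epsilon> * \<delta> * exp (p * s))"
          by (simp add: exp_diff exp_minus field_simps)
        also have "\<beta> * exp (2 * s) * (cos \<phi>)\<^sup>2 \<le> \<beta> * exp (2 * s) * 1"
          using c1 \<beta> by (intro mult_left_mono) auto
        then have "C * exp (\<beta> * exp (2 * s) * (cos \<phi>)\<^sup>2 - \<epsilon> * \<delta> * exp (p * s)) \<le> C * exp 0"
          using R(1) 4 C by (intro mult_left_mono) auto
        finally show ?thesis using CK by simp
      qed
    qed
    show ?thesis
    proof (rule maximum_modulus_frontier[where f = "H \<epsilon>" and S = "cbox 0 (Complex R \<psi>)"])
      have hol': "H \<epsilon> holomorphic_on UNIV"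
        unfolding H_def
        by (intro holomorphic_intros holomorphic_on_compose_gen[OF _ hol, unfolded o_def]) auto
      show "H \<epsilon> holomorphic_on interior (cbox 0 (Complex R \<psi>))"
        using hol' holomorphic_on_subset by blast
      show "continuous_on (closure (cbox 0 (Complex R \<psi>))) (H \<epsilon>)"
        using hol' holomorphic_on_imp_continuous_on continuous_on_subset by blast
      show "bounded (cbox 0 (Complex R \<psi>))" by simp
      show "norm (H \<epsilon> z) \<le> K" if "z \<in> frontier (cbox 0 (Complex R \<psi>))" for z
      proof -
        have "0 \<le> Re z" "Re z \<le> R" "0 \<le> Im z" "Im z \<le> \<psi>"
          and "Re z = 0 \<or> Re z = R \<or> Im z = 0 \<or> Im z = \<psi>"
          using that by (auto simp: frontier_cbox in_cbox_complex_iff in_box_complex_iff)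
        then show ?thesis using edge[of "Re z" "Im z"] by simp
      qed
      show "Complex s0 \<phi>0 \<in> cbox 0 (Complex R \<psi>)"
        using w0 R(2) by (simp add: in_cbox_complex_iff)
    qed
  qed
  have "norm (H 0 (Complex s0 \<phi>0)) \<le> K"
  proof (rule tendsto_upperbound)
    show "((\<lambda>\<epsilon>. norm (H \<epsilon> (Complex s0 \<phi>0))) \<longlongrightarrow> norm (H 0 (Complex s0 \<phi>0))) (at_right 0)"
      unfolding H_def by (intro tendsto_intros)
    show "eventually (\<lambda>\<epsilon>. norm (H \<epsilon> (Complex s0 \<phi>0)) \<le> K) (at_right 0)"
      using bound by (auto simp: eventually_at_filter)
  qed simp
  then show ?thesis
    by (simp add: normH K_def A_def exp_minus field_simps)
qed

text \<open>As \<open>\<psi>\<close> tends to \<open>pi / 2\<close>, \<open>cos \<psi>\<close> tends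
  to 0 and the exponential factor of the sector bound tends to 1. A fixed point off the imaginary
  axis lies in all sectors close enough to the quadrant.\<close>

lemma gaussian_growth_quadrant_bound:
  fixes h :: "complex \<Rightarrow> complex" and C \<beta> :: real
  assumes hol: "h holomorphic_on UNIV" and \<beta>: "\<beta> > 0"
    and growth: "\<And>z. norm (h z) \<le> C * exp (\<beta> * (Re z)\<^sup>2)"
    and real_bound: "\<And>x. norm (h (of_real x)) \<le> C"
    and z: "Re z \<ge> 0" "Im z \<ge> 0"
  shows "norm (h z) \<le> C * exp \<beta>"
proof -
  have C: "C \<ge> 0" using real_bound[of 0] norm_ge_zero order_trans by blast
  show ?thesis
  \<comment> \<open>The strip near the imaginary axis is controlled by the growth hypothesis alone.
    Outside it, \<open>z\<close> has modulus above 1 and argument below \<open>pi / 2\<close>, as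
    the sector bound requires.\<close>
  proof (cases "\<bar>Re z\<bar> \<le> 1")
    case True
    then have "(Re z)\<^sup>2 \<le> 1" by (simp add: abs_square_le_1)
    then have "C * exp (\<beta> * (Re z)\<^sup>2) \<le> C * exp \<beta>"
      using \<beta> C by (intro mult_left_mono) auto
    then show ?thesis using growth[of z] by linarith
  next
    case False
    then have "Re z > 1" using z by auto
    then have z0: "z \<noteq> 0" and nz: "norm z \<ge> 1"
      using complex_Re_le_cmod[of z] by auto
    define s \<phi> where "s = ln (norm z)" and "\<phi> = Im (Ln z)"
    have ez: "exp (Complex s \<phi>) = z"
      using z0 by (metis s_def \<phi>_def Re_Ln complex.collapse exp_Ln)
    have s: "s \<ge> 0" using nz by (simp add: s_def)
    have \<phi>: "0 \<le> \<phi>" "\<phi> < pi / 2"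
      using z \<open>Re z > 1\<close> z0 Im_Ln_pos_le[of z] Re_Ln_pos_lt[of z] by (auto simp: \<phi>_def)
    show ?thesis
    proof (rule tendsto_lowerbound)
      have "((\<lambda>\<psi>. C * exp \<beta> * exp (\<beta> * cos \<psi> / (2 * sin \<psi>) * exp (2 * s) * sin (2 * \<phi>)))
        \<longlongrightarrow> C * exp \<beta> * exp (\<beta> * cos (pi/2) / (2 * sin (pi/2)) * exp (2 * s) * sin (2 * \<phi>)))
        (at_left (pi / 2))"
        by (intro tendsto_intros) auto
      then show "((\<lambda>\<psi>. C * exp \<beta> * exp (\<beta> * cos \<psi> / (2 * sin \<psi>) * exp (2 * s) * sin (2 * \<phi>)))
        \<longlongrightarrow> C * exp \<beta>) (at_left (pi / 2))" by simp
      have "eventually (\<lambda>\<psi>. \<psi> \<in> {\<phi><..<pi/2}) (at_left (pi / 2))"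
        using \<phi> by (intro eventually_at_left_real)
      then show "eventually (\<lambda>\<psi>. norm (h z) \<le> C * exp \<beta> *
          exp (\<beta> * cos \<psi> / (2 * sin \<psi>) * exp (2 * s) * sin (2 * \<phi>))) (at_left (pi / 2))"
      proof eventually_elim
        case (elim \<psi>)
        then show ?case
          using gaussian_growth_sector_bound[OF hol \<beta> C growth real_bound, of \<psi> s \<phi>] s \<phi> by (simp add: ez)
      qed
    qed simp
  qed
qed

text \<open>The hypotheses are invariant under \<open>z \<mapsto> - z\<close> and under conjugation
  on both sides, so the quadrant bound carries over to the whole plane and Liouville's theorem
  applies.\<close>

lemma gaussian_growth_constant:
  fixes h :: "complex \<Rightarrow> complex" and C \<beta> :: real
  assumes hol: "h holomorphic_on UNIV" and \<beta>: "\<beta> > 0"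
    and growth: "\<And>z. norm (h z) \<le> C * exp (\<beta> * (Re z)\<^sup>2)"
    and real_bound: "\<And>x. norm (h (of_real x)) \<le> C"
  shows "h z = h 0"
proof -
  define hc where "hc = cnj \<circ> h \<circ> cnj"
  have hc: "hc holomorphic_on UNIV"
    unfolding hc_def using hol by (intro holomorphic_on_compose_cnj_cnj) (auto simp: image_iff)
  have neg: "(\<lambda>w. g (- w)) holomorphic_on UNIV" if "g holomorphic_on UNIV" for g :: "complex \<Rightarrow> complex"
    using that by (intro holomorphic_on_compose_gen[OF _ that, unfolded o_def] holomorphic_intros) auto
  have bounds: "norm (h (of_real x)) \<le> C" "norm (h (- of_real x)) \<le> C" for x
    using real_bound[of x] real_bound[of "- x"] by auto
  have growth': "norm (h z) \<le> C * exp (\<beta> * r\<^sup>2)" if "\<bar>Re z\<bar> = \<bar>r\<bar>" for z r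
    using growth[of z] that by (metis power2_abs)
  have "norm (h z) \<le> C * exp \<beta>" for z
  proof -
    consider "Re z \<ge> 0" "Im z \<ge> 0" | "Re z \<le> 0" "Im z \<le> 0"
      | "Re z \<ge> 0" "Im z \<le> 0" | "Re z \<le> 0" "Im z \<ge> 0" by linarith
    then show ?thesis
    proof cases
      case 1
      then show ?thesis
        using gaussian_growth_quadrant_bound[OF hol \<beta>] growth real_bound by blast
    next
      case 2
      have "norm (h (- (- z))) \<le> C * exp \<beta>"
        by (rule gaussian_growth_quadrant_bound[OF neg[OF hol] \<beta>])
          (use 2 bounds in \<open>auto intro!: growth'\<close>)
      then show ?thesis by simp
    next
      case 3
      have "norm (hc (cnj z)) \<le> C * exp \<beta>"
        by (rule gaussian_growth_quadrant_bound[OF hc \<beta>])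
          (use 3 bounds in \<open>auto simp: hc_def intro!: growth'\<close>)
      then show ?thesis by (simp add: hc_def)
    next
      case 4
      have "norm (hc (- (- cnj z))) \<le> C * exp \<beta>"
        by (rule gaussian_growth_quadrant_bound[OF neg[OF hc] \<beta>])
          (use 4 bounds in \<open>auto simp: hc_def intro!: growth'\<close>)
      then show ?thesis by (simp add: hc_def)
    qed
  qed
  then have "bounded (range h)" by (auto simp: bounded_iff)
  then show ?thesis
    using Liouville_theorem[OF hol] by (auto simp: constant_on_def)
qed

section \<open>Gaussian integrals\<close>

text \<open>Integrating the exponential series term by term gives a power series that converges
  everywhere.\<close>

lemma holomorphic_integral_exp:
  fixes g :: "'a \<Rightarrow> complex" and u :: "'a \<Rightarrow> real"
  assumes [measurable]: "g \<in> borel_measurable M" "u \<in> borel_measurable M"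
    and int: "\<And>r. integrable M (\<lambda>x. norm (g x) * exp (r * u x))"
  shows "(\<lambda>z. \<integral>x. g x * exp (z * of_real (u x)) \<partial>M) holomorphic_on UNIV"
proof -
  have sums: "(\<lambda>n. (\<integral>x. g x * (of_real (u x) ^ n / fact n) \<partial>M) * z ^ n) sums
      (\<integral>x. g x * exp (z * of_real (u x)) \<partial>M)" for z :: complex
  proof -
    define f where "f = (\<lambda>n x. g x * (z * of_real (u x)) ^ n / fact n)"
    have f_meas [measurable]: "f n \<in> borel_measurable M" for n unfolding f_def by measurable
    have normf: "norm (f n x) = norm (g x) * ((norm z * \<bar>u x\<bar>) ^ n /\<^sub>R fact n)" for n x
      by (simp add: f_def norm_mult norm_divide norm_power divide_inverse norm_inverse)
    have f_sums: "(\<lambda>n. f n x) sums (g x * exp (z * of_real (u x)))" for x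
      using sums_mult[OF exp_converges[of "z * of_real (u x)"], of "g x"]
      by (simp add: f_def scaleR_conv_of_real divide_inverse mult_ac)
    have norm_sums: "(\<lambda>n. norm (f n x)) sums (norm (g x) * exp (norm z * \<bar>u x\<bar>))" for x
      unfolding normf by (intro sums_mult exp_converges)
    \<comment> \<open>The exponential of an absolute value is at most the sum of the exponentials
      for both signs; each of these is integrable by hypothesis. This one function dominates all
      partial sums.\<close>
    have dom: "integrable M (\<lambda>x. norm (g x) * exp (norm z * \<bar>u x\<bar>))"
    proof (rule Bochner_Integration.integrable_bound)
      show "integrable M (\<lambda>x. norm (g x) * exp (norm z * u x) + norm (g x) * exp (- norm z * u x))"
        by (intro Bochner_Integration.integrable_add int)
      show "AE x in M. norm (norm (g x) * exp (norm z * \<bar>u x\<bar>))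
          \<le> norm (norm (g x) * exp (norm z * u x) + norm (g x) * exp (- norm z * u x))"
        by (intro AE_I2) (simp add: abs_if[of "u _"] abs_of_nonneg[OF add_nonneg_nonneg])
    qed simp
    have part: "(\<Sum>i<n. norm (f i x)) \<le> norm (g x) * exp (norm z * \<bar>u x\<bar>)" for n x
      using sum_le_suminf[OF sums_summable[OF norm_sums], of "{..<n}" x] sums_unique[OF norm_sums, of x]
      by simp
    have int_f: "integrable M (f n)" for n
      by (intro Bochner_Integration.integrable_bound[OF dom])
        (auto intro!: AE_I2 order_trans[OF _ part[of _ "Suc n"]] sum_nonneg)
    have "(\<lambda>n. integral\<^sup>L M (f n)) sums (\<integral>x. (\<Sum>n. f n x) \<partial>M)"
    proof (rule sums_integral[OF int_f])
      show "AE x in M. summable (\<lambda>n. norm (f n x))"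
        using norm_sums by (auto intro: sums_summable)
      show "summable (\<lambda>n. \<integral>x. norm (f n x) \<partial>M)"
      proof (rule bounded_imp_summable)
        show "(\<Sum>i\<le>n. \<integral>x. norm (f i x) \<partial>M) \<le> (\<integral>x. norm (g x) * exp (norm z * \<bar>u x\<bar>) \<partial>M)" for n
        proof -
          have "(\<Sum>i\<le>n. \<integral>x. norm (f i x) \<partial>M) = (\<integral>x. (\<Sum>i\<le>n. norm (f i x)) \<partial>M)"
            using int_f by (intro Bochner_Integration.integral_sum[symmetric] integrable_norm) auto
          also have "\<dots> \<le> (\<integral>x. norm (g x) * exp (norm z * \<bar>u x\<bar>) \<partial>M)"
            using part[of _ "Suc n"] int_f dom
            by (intro integral_mono) (auto simp: lessThan_Suc_atMost)
          finally show ?thesis .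
        qed
      qed simp
    qed
    moreover have "integral\<^sup>L M (f n) = (\<integral>x. g x * (of_real (u x) ^ n / fact n) \<partial>M) * z ^ n" for n
      by (subst integral_mult_left_zero[symmetric]) (simp add: f_def power_mult_distrib mult_ac)
    ultimately show ?thesis using sums_unique[OF f_sums] by simp
  qed
  have "(\<lambda>z. \<integral>x. g x * exp (z * of_real (u x)) \<partial>M) holomorphic_on ball 0 r" for r
    by (rule power_series_holomorphic[where a = "\<lambda>n. \<integral>x. g x * (of_real (u x) ^ n / fact n) \<partial>M"])
      (use sums in auto)
  then show ?thesis
    by (meson UNIV_I holomorphic_on_open open_UNIV open_ball holomorphic_on_def
        centre_in_ball mem_ball dist_commute less_add_one norm_ge_zero field_differentiable_at_within
        holomorphic_on_imp_differentiable_at dist_0_norm le_less_trans)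
qed

text \<open>The Gaussian is a product of one-dimensional Gaussians in the coordinates, and each of
  those is a multiple of a normal density.\<close>

lemma integrable_gaussian:
  assumes "\<gamma> > 0"
  shows "integrable lborel (\<lambda>x::'a::euclidean_space. exp (- \<gamma> * (norm x)\<^sup>2))"
proof -
  interpret product_sigma_finite "\<lambda>_::'a. lborel :: real measure" ..
  have 1: "integrable lborel (\<lambda>x::real. exp (- \<gamma> * x\<^sup>2))"
  proof -
    have "integrable lborel (normal_density 0 (1 / sqrt (2 * \<gamma>)))"
      using assms by simp
    then have "integrable lborel (\<lambda>x. sqrt (pi / \<gamma>) * normal_density 0 (1 / sqrt (2 * \<gamma>)) x)"
      by (intro integrable_mult_right)
    then show ?thesis using assms by (simp add: normal_density_def power_divide real_sqrt_divide mult.commute)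
  qed
  have "integrable (Pi\<^sub>M Basis (\<lambda>_::'a. lborel)) (\<lambda>x. \<Prod>i\<in>Basis. exp (- \<gamma> * (x i)\<^sup>2))"
    by (intro product_integrable_prod 1) auto
  also have "(\<lambda>x::'a \<Rightarrow> real. \<Prod>i\<in>Basis. exp (- \<gamma> * (x i)\<^sup>2)) =
      (\<lambda>x. exp (- \<gamma> * (norm (\<Sum>b\<in>Basis. x b *\<^sub>R b))\<^sup>2))"
  proof
    fix x :: "'a \<Rightarrow> real"
    have "(norm (\<Sum>b\<in>Basis. x b *\<^sub>R b))\<^sup>2 = (\<Sum>i\<in>Basis. (x i)\<^sup>2)"
      unfolding power2_norm_eq_inner
      by (subst euclidean_inner) (simp add: power2_eq_square)
    then show "(\<Prod>i\<in>Basis. exp (- \<gamma> * (x i)\<^sup>2)) = exp (- \<gamma> * (norm (\<Sum>b\<in>Basis. x b *\<^sub>R b))\<^sup>2)"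
      by (simp add: exp_sum[symmetric] sum_distrib_left sum_negf)
  qed
  finally show ?thesis
    unfolding lborel_eq[where 'a='a]
    by (subst integrable_distr_eq) auto
qed

text \<open>Completing the square turns the linear term into a translation by \<open>c\<close>,
  under which Lebesgue measure is invariant.\<close>

lemma integrable_gaussian_exp:
  fixes v :: "'a::euclidean_space"
  assumes "\<gamma> > 0"
  shows "integrable lborel (\<lambda>x. exp (- \<gamma> * (norm x)\<^sup>2 + inner v x))"
    and "(\<integral>x. exp (- \<gamma> * (norm x)\<^sup>2 + inner v x) \<partial>lborel)
      = (\<integral>x. exp (- \<gamma> * (norm (x::'a))\<^sup>2) \<partial>lborel) * exp ((norm v)\<^sup>2 / (4 * \<gamma>))"
proof -
  define c where "c = (- 1 / (2 * \<gamma>)) *\<^sub>R v"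
  have shift: "exp (- \<gamma> * (norm x)\<^sup>2 + inner v x) =
      exp (- \<gamma> * (norm (c + x))\<^sup>2) * exp ((norm v)\<^sup>2 / (4 * \<gamma>))" for x
    using assms by (simp add: c_def exp_add[symmetric] power2_norm_eq_inner inner_add inner_commute
        algebra_simps divide_simps)
  have "integrable (distr lborel borel ((+) c)) (\<lambda>x::'a. exp (- \<gamma> * (norm x)\<^sup>2))"
    using integrable_gaussian[OF assms] by (simp add: lborel_distr_plus)
  then show "integrable lborel (\<lambda>x. exp (- \<gamma> * (norm x)\<^sup>2 + inner v x))"
    unfolding shift by (subst (asm) integrable_distr_eq) auto
  have "(\<integral>x. exp (- \<gamma> * (norm (x::'a))\<^sup>2) \<partial>distr lborel borel ((+) c)) =
      (\<integral>x. exp (- \<gamma> * (norm (c + x))\<^sup>2) \<partial>lborel)"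
    by (subst integral_distr) auto
  then show "(\<integral>x. exp (- \<gamma> * (norm x)\<^sup>2 + inner v x) \<partial>lborel)
      = (\<integral>x. exp (- \<gamma> * (norm (x::'a))\<^sup>2) \<partial>lborel) * exp ((norm v)\<^sup>2 / (4 * \<gamma>))"
    unfolding shift by (simp add: lborel_distr_plus)
qed

lemma gaussian_integral_pos:
  assumes "\<gamma> > 0"
  shows "(\<integral>x. exp (- \<gamma> * (norm (x::'a::euclidean_space))\<^sup>2) \<partial>lborel) > 0"
proof -
  have "(\<integral>x. exp (- \<gamma> * (norm (x::'a))\<^sup>2) \<partial>lborel) \<noteq> 0"
    using integral_nonneg_eq_0_iff_AE[OF integrable_gaussian[OF assms, where 'a='a]]
    by (simp add: AE_iff_measurable[where N=UNIV])
  moreover have "(\<integral>x. exp (- \<gamma> * (norm (x::'a))\<^sup>2) \<partial>lborel) \<ge> 0"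
    by (intro Bochner_Integration.integral_nonneg) simp
  ultimately show ?thesis by linarith
qed

text \<open>For a real multiple \<open>r\<close> of the exponent this is the completed square. Both
  sides are entire in \<open>r\<close>, so the identity extends to \<open>r = \<i>\<close>.\<close>

lemma fourier_gaussian:
  fixes v :: "'a::euclidean_space"
  assumes "\<gamma> > 0"
  shows "(\<integral>x. of_real (exp (- \<gamma> * (norm x)\<^sup>2)) * exp (\<i> * of_real (inner v x)) \<partial>lborel)
      = complex_of_real ((\<integral>x. exp (- \<gamma> * (norm (x::'a))\<^sup>2) \<partial>lborel) * exp (- (norm v)\<^sup>2 / (4 * \<gamma>)))"
proof -
  define K where "K = (\<integral>x. exp (- \<gamma> * (norm (x::'a))\<^sup>2) \<partial>lborel)"
  define F where "F = (\<lambda>z. \<integral>x. complex_of_real (exp (- \<gamma> * (norm x)\<^sup>2)) * exp (z * of_real (inner v x)) \<partial>lborel)"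
  define G where "G = (\<lambda>z::complex. of_real K * exp (z\<^sup>2 * of_real ((norm v)\<^sup>2 / (4 * \<gamma>))))"
  have F: "F holomorphic_on UNIV"
    unfolding F_def
  proof (rule holomorphic_integral_exp)
    show "integrable lborel (\<lambda>x. norm (complex_of_real (exp (- \<gamma> * (norm x)\<^sup>2))) * exp (r * inner v x))" for r
      using integrable_gaussian_exp(1)[OF assms, of "r *\<^sub>R v"] by (simp add: mult_exp_exp)
  qed auto
  have G: "G holomorphic_on UNIV" unfolding G_def by (intro holomorphic_intros)
  have eq: "F (of_real r) = G (of_real r)" for r
  proof -
    have "F (of_real r) = (\<integral>x. complex_of_real (exp (- \<gamma> * (norm x)\<^sup>2 + inner (r *\<^sub>R v) x)) \<partial>lborel)"
      by (simp only: F_def exp_add of_real_mult inner_scaleR_left exp_of_real[symmetric])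
    also have "\<dots> = complex_of_real (K * exp ((norm (r *\<^sub>R v))\<^sup>2 / (4 * \<gamma>)))"
      unfolding integral_complex_of_real K_def integrable_gaussian_exp(2)[OF assms] ..
    also have "\<dots> = G (of_real r)"
      by (simp add: G_def exp_of_real[symmetric] power_mult_distrib)
    finally show ?thesis .
  qed
  have "F \<i> - G \<i> = 0"
  proof (rule analytic_continuation[where f = "\<lambda>z. F z - G z" and S = UNIV and U = "range of_real" and \<xi> = 0])
    show "(\<lambda>z. F z - G z) holomorphic_on UNIV" using F G by (intro holomorphic_intros)
    show "0 islimpt range complex_of_real"
      unfolding islimpt_approachable
    proof (intro allI impI)
      fix e :: real assume "e > 0"
      then show "\<exists>x'\<in>range of_real. x' \<noteq> 0 \<and> dist x' (0::complex) < e"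
        by (intro bexI[of _ "of_real (e / 2)"] rangeI) (auto simp: norm_divide)
    qed
  qed (use eq in auto)
  then show ?thesis
    by (simp add: F_def G_def K_def exp_of_real[symmetric])
qed

section \<open>Injectivity of the Fourier transform\<close>

lemma lebesgue_borel_measurable:
  fixes f :: "'a::euclidean_space \<Rightarrow> 'b::topological_space"
  shows "f \<in> borel_measurable borel \<Longrightarrow> f \<in> borel_measurable lebesgue"
  by (simp add: measurable_completion)

text \<open>Pushing a weight of total mass 1 forward along \<open>u\<close> gives a probability law
  on the line whose characteristic function is a Fourier integral of the weight. This makes Levy's
  uniqueness theorem applicable.\<close>

lemma weighted_distr:
  fixes h u :: "'a \<Rightarrow> real"
  assumes h: "integrable M h" "\<And>x. 0 \<le> h x" "integral\<^sup>L M h = 1"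
    and u [measurable]: "u \<in> borel_measurable M"
  defines "N \<equiv> distr (density M h) borel u"
  shows "real_distribution N"
    and "char N t = (\<integral>x. of_real (h x) * exp (\<i> * of_real (t * u x)) \<partial>M)"
    and "B \<in> sets borel \<Longrightarrow> measure N B = (\<integral>x. h x * indicator B (u x) \<partial>M)"
proof -
  have [measurable]: "h \<in> borel_measurable M" using h by auto
  have "emeasure (density M h) (space M) = 1"
    using h by (simp add: emeasure_density nn_integral_eq_integral cong: nn_integral_cong)
  then interpret D: prob_space "density M h" by (intro prob_spaceI) simp
  interpret N: prob_space N unfolding N_def by (intro D.prob_space_distr) simp
  show "real_distribution N"
    by unfold_locales (simp_all add: N_def)
  show "char N t = (\<integral>x. of_real (h x) * exp (\<i> * of_real (t * u x)) \<partial>M)"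
    using h unfolding char_def N_def
    by (subst integral_distr) (simp_all add: integral_density scaleR_conv_of_real)
  assume B [measurable]: "B \<in> sets borel"
  have "measure N B = (\<integral>y. indicator B y \<partial>N)"
    by (simp add: N_def)
  also have "\<dots> = (\<integral>x. h x * indicator B (u x) \<partial>M)"
    using h unfolding N_def by (subst integral_distr) (simp_all add: integral_density)
  finally show "measure N B = (\<integral>x. h x * indicator B (u x) \<partial>M)" .
qed

lemma integrable_mult_bounded:
  fixes f g :: "'a \<Rightarrow> 'b::{real_normed_algebra, banach, second_countable_topology}"
  assumes "integrable M f" "g \<in> borel_measurable M" "\<And>x. norm (g x) \<le> 1"
  shows "integrable M (\<lambda>x. f x * g x)"
proof (rule Bochner_Integration.integrable_bound[OF assms(1)])
  show "(\<lambda>x. f x * g x) \<in> borel_measurable M"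
    using assms(1,2) by (intro borel_measurable_times) auto
  show "AE x in M. norm (f x * g x) \<le> norm (f x)"
    using assms(3) by (intro AE_I2 order_trans[OF norm_mult_ineq] mult_left_le) auto
qed

text \<open>The positive and negative parts of \<open>g\<close> have equal mass \<open>c\<close>, by
  \<open>t = 0\<close>. If \<open>c\<close> is 0 both vanish almost everywhere; otherwise, divided
  by \<open>c\<close>, they push forward to laws with the same characteristic function, hence to the
  same law.\<close>

lemma fourier_zero_imp_integral_vimage_zero_real:
  fixes g u :: "'a \<Rightarrow> real"
  assumes g: "integrable M g" and u [measurable]: "u \<in> borel_measurable M"
    and zero: "\<And>t. (\<integral>x. of_real (g x) * exp (\<i> * of_real (t * u x)) \<partial>M) = 0"
    and B [measurable]: "B \<in> sets borel"
  shows "(\<integral>x. g x * indicator B (u x) \<partial>M) = 0"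
proof -
  define p m where "p = (\<lambda>x. max 0 (g x))" and "m = (\<lambda>x. max 0 (- g x))"
  have pm: "g x = p x - m x" "p x \<ge> 0" "m x \<ge> 0" for x by (auto simp: p_def m_def)
  have ip [simp]: "integrable M p" and im [simp]: "integrable M m"
    using g by (auto simp: p_def m_def)
  have g' [measurable]: "p \<in> borel_measurable M" "m \<in> borel_measurable M" using ip im by blast+
  have int_exp: "complex_integrable M (\<lambda>x. of_real (q x) * exp (\<i> * of_real (t * u x)))"
    if "integrable M q" for q t
    using that by (intro integrable_mult_bounded) auto
  have eq: "(\<integral>x. of_real (p x) * exp (\<i> * of_real (t * u x)) \<partial>M) =
      (\<integral>x. of_real (m x) * exp (\<i> * of_real (t * u x)) \<partial>M)" for t
    using zero[of t] Bochner_Integration.integral_diff[OF int_exp[OF ip] int_exp[OF im], of t t]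
    by (simp only: pm(1) of_real_diff left_diff_distrib) simp
  define c where "c = integral\<^sup>L M p"
  have cm: "integral\<^sup>L M m = c"
    using eq[of 0] by (simp add: c_def)
  have c0: "c \<ge> 0" by (simp add: c_def pm integral_nonneg)
  have "(\<integral>x. p x * indicator B (u x) \<partial>M) = (\<integral>x. m x * indicator B (u x) \<partial>M)"
  proof (cases "c = 0")
    case True
    have "AE x in M. p x = 0" "AE x in M. m x = 0"
      using True cm integral_nonneg_eq_0_iff_AE[OF ip] integral_nonneg_eq_0_iff_AE[OF im] pm
      by (auto simp: c_def)
    then show ?thesis
      by (intro integral_cong_AE) auto
  next
    case False
    have p1: "integrable M (\<lambda>x. p x / c)" "\<And>x. 0 \<le> p x / c" "(\<integral>x. p x / c \<partial>M) = 1"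
      and m1: "integrable M (\<lambda>x. m x / c)" "\<And>x. 0 \<le> m x / c" "(\<integral>x. m x / c \<partial>M) = 1"
      using False c0 cm pm by (auto simp: c_def)
    note W = weighted_distr[OF p1 u] and V = weighted_distr[OF m1 u]
    have "distr (density M (\<lambda>x. p x / c)) borel u = distr (density M (\<lambda>x. m x / c)) borel u"
    proof (rule Levy_uniqueness[OF W(1) V(1)], rule ext)
      fix t
      show "char (distr (density M (\<lambda>x. p x / c)) borel u) t =
          char (distr (density M (\<lambda>x. m x / c)) borel u) t"
        unfolding W(2) V(2) using eq[of t] by simp
    qed
    then have "(\<integral>x. p x / c * indicator B (u x) \<partial>M) = (\<integral>x. m x / c * indicator B (u x) \<partial>M)"
      by (simp only: W(3)[OF B, symmetric] V(3)[OF B, symmetric])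
    then show ?thesis using False by simp
  qed
  then show ?thesis
    by (simp add: pm(1) left_diff_distrib integrable_mult_bounded indicator_def)
qed

text \<open>Real and imaginary parts inherit the vanishing transform, because the hypothesis covers
  both \<open>t\<close> and \<open>- t\<close>.\<close>

lemma fourier_zero_imp_integral_vimage_zero:
  fixes g :: "'a \<Rightarrow> complex" and u :: "'a \<Rightarrow> real"
  assumes g: "integrable M g" and u [measurable]: "u \<in> borel_measurable M"
    and zero: "\<And>t. (\<integral>x. g x * exp (\<i> * of_real (t * u x)) \<partial>M) = 0"
    and B [measurable]: "B \<in> sets borel"
  shows "(\<integral>x. g x * indicator B (u x) \<partial>M) = 0"
proof -
  have re: "(\<integral>x. Re (k x) * indicator B (u x) \<partial>M) = 0"
    if k: "integrable M k" and k0: "\<And>t. (\<integral>x. k x * exp (\<i> * of_real (t * u x)) \<partial>M) = 0" for k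
  proof (rule fourier_zero_imp_integral_vimage_zero_real[OF _ u _ B])
    show "integrable M (\<lambda>x. Re (k x))" using k by simp
    fix t
    have int: "complex_integrable M (\<lambda>x. k x * exp (\<i> * of_real (t * u x)))"
      "complex_integrable M (\<lambda>x. cnj (k x * exp (\<i> * of_real (- t * u x))))" for t
      using k by (auto intro!: integrable_mult_bounded simp del: complex_cnj_mult)
    \<comment> \<open>The transform of the real part at \<open>t\<close> is the mean of the
      transform of \<open>k\<close> at \<open>t\<close> and the conjugate of that at
      \<open>- t\<close>.\<close>
    have "of_real (Re (k x)) * exp (\<i> * of_real (t * u x)) =
        (k x * exp (\<i> * of_real (t * u x)) + cnj (k x * exp (\<i> * of_real (- t * u x)))) / 2" for x
      using complex_add_cnj[of "k x"] by (simp add: exp_cnj ring_distribs[symmetric])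
    then have "(\<integral>x. of_real (Re (k x)) * exp (\<i> * of_real (t * u x)) \<partial>M) =
        ((\<integral>x. k x * exp (\<i> * of_real (t * u x)) \<partial>M)
          + (\<integral>x. cnj (k x * exp (\<i> * of_real (- t * u x))) \<partial>M)) / 2"
      by (simp only: integral_divide_zero Bochner_Integration.integral_add[OF int])
    moreover have "(\<integral>x. cnj (k x * exp (\<i> * of_real (- t * u x))) \<partial>M) = 0"
      by (subst Bochner_Integration.integral_cnj) (simp only: k0 complex_cnj_zero)
    ultimately show "(\<integral>x. of_real (Re (k x)) * exp (\<i> * of_real (t * u x)) \<partial>M) = 0"
      by (simp only: k0) simp
  qed
  have int: "complex_integrable M (\<lambda>x. g x * indicator B (u x))"
    using g by (intro integrable_mult_bounded) (auto simp: indicator_def)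
  have ri: "Re (g x * indicator B (u x)) = Re (g x) * indicator B (u x)"
    "Im (g x * indicator B (u x)) = Im (g x) * indicator B (u x)" for x
    by (auto simp: indicator_def)
  \<comment> \<open>The imaginary part of \<open>g\<close> is the real part of
    \<open>- \<i> * g\<close>.\<close>
  have "(\<integral>x. (- \<i> * g x) * exp (\<i> * of_real (t * u x)) \<partial>M) = 0" for t
    using zero[of t] by (simp add: mult.assoc)
  then have "(\<integral>x. Im (g x) * indicator B (u x) \<partial>M) = 0"
    using re[of "\<lambda>x. - \<i> * g x"] g by simp
  moreover have "(\<integral>x. Re (g x) * indicator B (u x) \<partial>M) = 0"
    using re[OF g zero] .
  ultimately show ?thesis
    using integral_Re[OF int] integral_Im[OF int] ri by (simp add: complex_eq_iff)
qed

text \<open>Cutting \<open>g\<close> down to a slab in one coordinate preserves the vanishing of its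
  transform. Doing so for every coordinate shows that \<open>g\<close> integrates to 0 over boxes,
  then over Borel and finally over Lebesgue sets.\<close>

lemma fourier_zero_imp_AE_zero:
  fixes g :: "'a::euclidean_space \<Rightarrow> complex"
  assumes g: "integrable lebesgue g"
    and zero: "\<And>v. (\<integral>x. g x * exp (\<i> * of_real (inner v x)) \<partial>lebesgue) = 0"
  shows "AE x in lebesgue. g x = 0"
proof -
  have prod: "integrable lebesgue (\<lambda>x. g x * (\<Prod>b\<in>A. indicator (S b) (inner x b))) \<and>
      (\<forall>v. (\<integral>x. g x * (\<Prod>b\<in>A. indicator (S b) (inner x b)) * exp (\<i> * of_real (inner v x)) \<partial>lebesgue) = 0)"
    if "finite A" and S: "\<And>b. S b \<in> sets borel" for A S
    using \<open>finite A\<close>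
  proof induction
    case empty
    then show ?case using g zero by simp
  next
    case (insert b A)
    define k where "k = (\<lambda>x. g x * (\<Prod>b\<in>A. indicator (S b) (inner x b)))"
    have k: "integrable lebesgue k" "\<And>v. (\<integral>x. k x * exp (\<i> * of_real (inner v x)) \<partial>lebesgue) = 0"
      using insert.IH by (auto simp: k_def)
    have u: "(\<lambda>x. inner x b) \<in> borel_measurable lebesgue" by (intro lebesgue_borel_measurable) measurable
    have ind: "(\<lambda>x. indicator (S b) (inner x b) :: complex) \<in> borel_measurable lebesgue"
      by (intro lebesgue_borel_measurable measurable_compose[OF _ borel_measurable_indicator[OF S[of b]]]) simp
    have eq: "g x * (\<Prod>b\<in>insert b A. indicator (S b) (inner x b)) = k x * indicator (S b) (inner x b)" for x
      using insert.hyps by (simp add: k_def)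
    have "(\<integral>x. k x * indicator (S b) (inner x b) * exp (\<i> * of_real (inner v x)) \<partial>lebesgue) = 0" for v
    proof -
      have "(\<integral>x. (k x * exp (\<i> * of_real (inner v x))) * indicator (S b) (inner x b) \<partial>lebesgue) = 0"
      proof (rule fourier_zero_imp_integral_vimage_zero[OF _ u _ S])
        show "complex_integrable lebesgue (\<lambda>x. k x * exp (\<i> * of_real (inner v x)))"
          by (intro integrable_mult_bounded k lebesgue_borel_measurable) auto
        \<comment> \<open>The extra oscillation in coordinate \<open>b\<close> only shifts the
          frequency to \<open>v + t *\<^sub>R b\<close>, where the transform of \<open>k\<close>
          vanishes as well.\<close>
        show "(\<integral>x. k x * exp (\<i> * of_real (inner v x)) * exp (\<i> * of_real (t * inner x b)) \<partial>lebesgue) = 0" for t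
          using k(2)[of "v + t *\<^sub>R b"]
          by (simp add: inner_add_left inner_commute[of b] mult.assoc mult_exp_exp distrib_left)
      qed
      then show ?thesis by (simp add: mult_ac)
    qed
    moreover have "integrable lebesgue (\<lambda>x. k x * indicator (S b) (inner x b))"
      using ind by (intro integrable_mult_bounded k) (auto simp: indicator_def)
    ultimately show ?case unfolding eq by blast
  qed
  have box0: "(LINT x:box l u|lebesgue. g x) = 0" for l u :: 'a
  proof -
    have "indicator (box l u) x = (\<Prod>b\<in>Basis. indicator {inner l b<..<inner u b} (inner x b) :: complex)" for x
    proof (cases "x \<in> box l u")
      case False
      then obtain b where "b \<in> Basis" "inner x b \<notin> {inner l b<..<inner u b}"
        by (auto simp: box_def)
      then have "(\<Prod>b\<in>Basis. indicator {inner l b<..<inner u b} (inner x b) :: complex) = 0"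
        by (intro prod_zero bexI[of _ b]) auto
      then show ?thesis using False by simp
    qed (simp add: box_def)
    then have "(\<integral>x. g x * indicator (box l u) x \<partial>lebesgue) = 0"
      using prod[of Basis "\<lambda>b. {inner l b<..<inner u b}"] by (auto dest: spec[of _ 0])
    moreover have "indicat_real (box l u) x *\<^sub>R g x = g x * indicator (box l u) x" for x
      by (simp add: indicator_def)
    ultimately show ?thesis by (simp add: set_lebesgue_integral_def)
  qed
  have int_ind: "integrable lebesgue (\<lambda>x. indicator A x *\<^sub>R g x)" if "A \<in> sets lebesgue" for A
    using that g by (rule integrable_mult_indicator)
  \<comment> \<open>Frequency 0 gives the integral over the whole space, needed for complements in
    the Dynkin argument below.\<close>
  have total: "(\<integral>x. g x \<partial>lebesgue) = 0" using zero[of 0] by simp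
  have borel: "(LINT x:A|lebesgue. g x) = 0" if "A \<in> sets borel" for A
  proof -
    have "Int_stable (range (\<lambda>(a, b). box a b :: 'a set))"
      by (auto simp: Int_stable_def box_Int_box)
    moreover have "range (\<lambda>(a, b). box a b :: 'a set) \<subseteq> Pow UNIV" by simp
    moreover have "A \<in> sigma_sets UNIV (range (\<lambda>(a, b). box a b))"
      using that by (simp add: borel_eq_box)
    ultimately show ?thesis
    proof (induction rule: sigma_sets_induct_disjoint)
      fix A assume "A \<in> range (\<lambda>(a, b). box a b :: 'a set)"
      then show "(LINT x:A|lebesgue. g x) = 0"
        using box0 by auto
    next
      show "(LINT x:{}|lebesgue. g x) = 0" by (simp add: set_lebesgue_integral_def)
    next
      fix A :: "'a set"
      assume "A \<in> sigma_sets UNIV (range (\<lambda>(a, b). box a b))" and A0: "(LINT x:A|lebesgue. g x) = 0"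
      then have "A \<in> sets borel" by (simp add: borel_eq_box)
      then have A: "A \<in> sets lebesgue" by (simp add: sets_completionI_sets)
      have "(LINT x:UNIV - A|lebesgue. g x) = (\<integral>x. g x - indicator A x *\<^sub>R g x \<partial>lebesgue)"
        unfolding set_lebesgue_integral_def
        by (intro Bochner_Integration.integral_cong) (auto simp: indicator_def)
      also have "\<dots> = 0"
        using A0 total g int_ind[OF A] by (simp add: set_lebesgue_integral_def)
      finally show "(LINT x:UNIV - A|lebesgue. g x) = 0" .
    next
      fix A :: "nat \<Rightarrow> 'a set"
      assume d: "disjoint_family A" and A: "range A \<subseteq> sigma_sets UNIV (range (\<lambda>(a, b). box a b))"
        and A0: "\<And>i. (LINT x:A i|lebesgue. g x) = 0"
      have A': "A i \<in> sets lebesgue" for i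
      proof -
        have "A i \<in> sets borel" using A by (auto simp: borel_eq_box)
        then show ?thesis by (simp add: sets_completionI_sets)
      qed
      have "(LINT x:(\<Union>i. A i)|lebesgue. g x) = (\<Sum>i. (LINT x:A i|lebesgue. g x))"
        using A' d g
        by (intro lebesgue_integral_countable_add)
          (auto simp: disjoint_family_on_def set_integrable_def intro!: int_ind)
      then show "(LINT x:(\<Union>i. A i)|lebesgue. g x) = 0" using A0 by simp
    qed
  qed
  interpret lebesgue: sigma_finite_measure "lebesgue :: 'a measure"
  proof
    obtain S :: "'a set set" where "countable S" "S \<subseteq> sets lborel" "\<Union>S = space lborel"
      "\<forall>a\<in>S. emeasure lborel a \<noteq> \<infinity>"
      using lborel.sigma_finite_countable by blast
    then show "\<exists>A::'a set set. countable A \<and> A \<subseteq> sets lebesgue \<and> \<Union>A = space lebesgue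
        \<and> (\<forall>a\<in>A. emeasure lebesgue a \<noteq> \<infinity>)"
      by (intro exI[of _ S]) (auto intro: sets_completionI_sets simp: subset_iff)
  qed
  show ?thesis
  proof (rule lebesgue.density_zero[OF g])
    fix A :: "'a set" assume A: "A \<in> sets lebesgue"
    \<comment> \<open>A Lebesgue set differs from a Borel set only inside a null set.\<close>
    then obtain S N N' where S: "A = S \<union> N" "N \<subseteq> N'" "N' \<in> null_sets lborel" "S \<in> sets lborel"
      by (rule sets_completionE)
    have S': "S \<in> sets lebesgue" using S by (auto intro: sets_completionI_sets)
    have "N' \<in> null_sets lebesgue" using S(3) by (rule null_sets_completionI)
    then have "AE x in lebesgue. x \<notin> N'" by (rule AE_not_in)
    then have "(LINT x:A|lebesgue. g x) = (LINT x:S|lebesgue. g x)"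
      unfolding set_lebesgue_integral_def
      using int_ind[OF A] int_ind[OF S'] S(1,2)
      by (intro integral_cong_AE) (auto simp: indicator_def elim!: eventually_mono)
    then show "(LINT x:A|lebesgue. g x) = 0" using borel[of S] S by simp
  qed
qed

section \<open>Hardy's theorem for the classical transform\<close>

text \<open>Along the line \<open>t \<mapsto> t v\<close> the Fourier transform extends to an entire function; its product with
  \<open>exp (b w\<^sup>2)\<close>, where \<open>b\<close> is \<open>(norm v)\<^sup>2 / (4 * \<alpha>)\<close>, is bounded on the real axis and
  \<open>O (exp (b (Re w)\<^sup>2))\<close>, hence constant.\<close>

lemma hardy_fourier_transform:
  fixes g :: "'a::euclidean_space \<Rightarrow> complex"
  assumes \<alpha>: "\<alpha> > 0" and g: "integrable lebesgue g"
    and g_le: "\<And>x. norm (g x) \<le> C * exp (- \<alpha> * (norm x)\<^sup>2)"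
    and ft_le: "\<And>v. norm (\<integral>x. g x * exp (\<i> * of_real (inner v x)) \<partial>lebesgue)
      \<le> C' * exp (- (norm v)\<^sup>2 / (4 * \<alpha>))"
  shows "(\<integral>x. g x * exp (\<i> * of_real (inner v x)) \<partial>lebesgue)
    = (\<integral>x. g x \<partial>lebesgue) * of_real (exp (- (norm v)\<^sup>2 / (4 * \<alpha>)))"
proof (cases "v = 0")
  case False
  define K where "K = (\<integral>x. exp (- \<alpha> * (norm (x::'a))\<^sup>2) \<partial>lborel)"
  define b where "b = (norm v)\<^sup>2 / (4 * \<alpha>)"
  have b: "b > 0" using False \<alpha> by (simp add: b_def)
  define G where "G = (\<lambda>z. \<integral>x. g x * exp (z * of_real (inner v x)) \<partial>lebesgue)"
  define h where "h = (\<lambda>w. G (\<i> * w) * exp (of_real b * w\<^sup>2))"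
  have C: "C \<ge> 0" using order_trans[OF norm_ge_zero g_le[of 0]] by simp
  have K: "K \<ge> 0" using gaussian_integral_pos[OF \<alpha>] unfolding K_def by (rule less_imp_le)
  have dom: "integrable lebesgue (\<lambda>x. C * exp (- \<alpha> * (norm x)\<^sup>2 + inner (r *\<^sub>R v) x))"
    and dom_int: "(\<integral>x. C * exp (- \<alpha> * (norm x)\<^sup>2 + inner (r *\<^sub>R v) x) \<partial>lebesgue) = C * K * exp (b * r\<^sup>2)" for r
  proof -
    show "integrable lebesgue (\<lambda>x. C * exp (- \<alpha> * (norm x)\<^sup>2 + inner (r *\<^sub>R v) x))"
      by (intro integrable_mult_right, subst integrable_completion)
        (use integrable_gaussian_exp(1)[OF \<alpha>, of "r *\<^sub>R v"] in auto)
    have "(\<integral>x. exp (- \<alpha> * (norm x)\<^sup>2 + inner (r *\<^sub>R v) x) \<partial>lebesgue) = K * exp (b * r\<^sup>2)"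
      using integrable_gaussian_exp(2)[OF \<alpha>, of "r *\<^sub>R v"]
      by (subst integral_completion) (auto simp: K_def b_def power_mult_distrib mult_ac)
    then show "(\<integral>x. C * exp (- \<alpha> * (norm x)\<^sup>2 + inner (r *\<^sub>R v) x) \<partial>lebesgue) = C * K * exp (b * r\<^sup>2)"
      by simp
  qed
  have g_exp_le: "norm (g x) * exp (r * inner v x) \<le> C * exp (- \<alpha> * (norm x)\<^sup>2 + inner (r *\<^sub>R v) x)" for x r
    using mult_right_mono[OF g_le[of x], of "exp (r * inner v x)"] by (simp add: exp_add mult.assoc mult_exp_exp)
  have g_exp_int: "integrable lebesgue (\<lambda>x. norm (g x) * exp (r * inner v x))" for r
  proof (rule Bochner_Integration.integrable_bound[OF dom])
    show "(\<lambda>x. norm (g x) * exp (r * inner v x)) \<in> borel_measurable lebesgue"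
      by (intro borel_measurable_times borel_measurable_integrable[OF integrable_norm[OF g]]
          lebesgue_borel_measurable) measurable
    show "AE x in lebesgue. norm (norm (g x) * exp (r * inner v x))
        \<le> norm (C * exp (- \<alpha> * (norm x)\<^sup>2 + inner (r *\<^sub>R v) x))"
      using g_exp_le C by (intro AE_I2) (simp add: abs_mult)
  qed
  have G_hol: "G holomorphic_on UNIV"
    unfolding G_def using g g_exp_int
    by (intro holomorphic_integral_exp) (auto intro: lebesgue_borel_measurable)
  have h_hol: "h holomorphic_on UNIV"
    unfolding h_def
    by (intro holomorphic_intros holomorphic_on_compose_gen[OF _ G_hol, unfolded o_def]) auto
  have G_le: "norm (G (\<i> * w)) \<le> C * K * exp (b * (Im w)\<^sup>2)" for w
  proof -
    have "norm (G (\<i> * w)) \<le> (\<integral>x. norm (g x * exp (\<i> * w * of_real (inner v x))) \<partial>lebesgue)"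
      unfolding G_def by (rule integral_norm_bound)
    also have "\<dots> = (\<integral>x. norm (g x) * exp (- Im w * inner v x) \<partial>lebesgue)"
      by (simp add: norm_mult)
    also have "\<dots> \<le> (\<integral>x. C * exp (- \<alpha> * (norm x)\<^sup>2 + inner ((- Im w) *\<^sub>R v) x) \<partial>lebesgue)"
      by (intro integral_mono g_exp_int dom g_exp_le)
    also have "\<dots> = C * K * exp (b * (Im w)\<^sup>2)"
      unfolding dom_int by simp
    finally show ?thesis .
  qed
  \<comment> \<open>The real part of \<open>w\<^sup>2\<close> is
    \<open>(Re w)\<^sup>2 - (Im w)\<^sup>2\<close>, so the Gaussian factor trades growth in
    \<open>Im w\<close> for growth in \<open>Re w\<close>. In the maximum, \<open>C * K\<close>
    serves the growth bound and \<open>C'\<close> the bound on the real axis.\<close>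
  have "h 1 = h 0"
  proof (rule gaussian_growth_constant[OF h_hol b])
    fix w :: complex
    have "norm (h w) \<le> C * K * exp (b * (Im w)\<^sup>2) * exp (b * ((Re w)\<^sup>2 - (Im w)\<^sup>2))"
      unfolding h_def norm_mult using G_le[of w]
      by (intro mult_mono) (auto simp: power2_eq_square C K)
    also have "\<dots> = C * K * exp (b * (Re w)\<^sup>2)"
      by (simp add: mult.assoc mult_exp_exp algebra_simps)
    also have "\<dots> \<le> max (C * K) C' * exp (b * (Re w)\<^sup>2)"
      by (intro mult_right_mono) auto
    finally show "norm (h w) \<le> max (C * K) C' * exp (b * (Re w)\<^sup>2)" .
  next
    fix x :: real
    have "norm (h (of_real x)) = norm (G (\<i> * of_real x)) * exp (b * x\<^sup>2)"
      by (simp add: h_def norm_mult power2_eq_square)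
    also have "\<dots> \<le> C' * exp (- b * x\<^sup>2) * exp (b * x\<^sup>2)"
      using ft_le[of "x *\<^sub>R v"]
      by (intro mult_right_mono) (auto simp: G_def b_def power_mult_distrib mult_ac)
    also have "\<dots> = C'" by (simp add: mult.assoc mult_exp_exp)
    finally show "norm (h (of_real x)) \<le> max (C * K) C'" by simp
  qed
  \<comment> \<open>\<open>G \<i>\<close> is the transform at \<open>v\<close>, and
    \<open>G 0\<close> is the integral of \<open>g\<close>.\<close>
  then have "G \<i> * exp (of_real b) = G 0" by (simp add: h_def)
  then have "G \<i> = G 0 * exp (- of_real b)" by (simp add: exp_minus field_simps)
  then show ?thesis
    by (simp add: G_def b_def exp_of_real[symmetric])
qed simp

text \<open>The transform of \<open>g\<close> is that of a Gaussian with the same integral, which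
  fixes \<open>c\<close>. The difference has vanishing transform and is therefore null.\<close>

theorem hardy_critical:
  fixes g :: "'a::euclidean_space \<Rightarrow> complex"
  assumes \<alpha>: "\<alpha> > 0" and g: "integrable lebesgue g"
    and g_le: "\<And>x. norm (g x) \<le> C * exp (- \<alpha> * (norm x)\<^sup>2)"
    and ft_le: "\<And>v. norm (\<integral>x. g x * exp (\<i> * of_real (inner v x)) \<partial>lebesgue)
      \<le> C' * exp (- (norm v)\<^sup>2 / (4 * \<alpha>))"
  shows "\<exists>c. AE x in lebesgue. g x = c * of_real (exp (- \<alpha> * (norm x)\<^sup>2))"
proof -
  define K where "K = (\<integral>x. exp (- \<alpha> * (norm (x::'a))\<^sup>2) \<partial>lborel)"
  define c where "c = (\<integral>x. g x \<partial>lebesgue) / of_real K"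
  define E where "E = (\<lambda>x::'a. complex_of_real (exp (- \<alpha> * (norm x)\<^sup>2)))"
  have K: "K > 0" unfolding K_def by (rule gaussian_integral_pos[OF \<alpha>])
  have E_borel: "E \<in> borel_measurable borel" unfolding E_def by measurable
  have E_int: "integrable lebesgue E"
    using E_borel integrable_gaussian[OF \<alpha>, where 'a='a]
    by (subst integrable_completion) (auto simp: E_def)
  have osc: "complex_integrable lebesgue (\<lambda>x. f x * exp (\<i> * of_real (inner v x)))"
    if "complex_integrable lebesgue f" for f v
    using that by (intro integrable_mult_bounded lebesgue_borel_measurable) auto
  have E_ft: "(\<integral>x. E x * exp (\<i> * of_real (inner v x)) \<partial>lebesgue) = of_real (K * exp (- (norm v)\<^sup>2 / (4 * \<alpha>)))" for v
    unfolding K_def fourier_gaussian[OF \<alpha>, symmetric] E_def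
    by (rule integral_completion) measurable
  have "AE x in lebesgue. g x - c * E x = 0"
  proof (rule fourier_zero_imp_AE_zero)
    show "integrable lebesgue (\<lambda>x. g x - c * E x)"
      using g E_int by auto
    fix v
    have "(\<integral>x. (g x - c * E x) * exp (\<i> * of_real (inner v x)) \<partial>lebesgue) =
        (\<integral>x. g x * exp (\<i> * of_real (inner v x)) \<partial>lebesgue) -
        c * (\<integral>x. E x * exp (\<i> * of_real (inner v x)) \<partial>lebesgue)"
      using osc[OF g, of v] osc[OF E_int, of v] by (simp add: left_diff_distrib mult.assoc)
    also have "\<dots> = 0"
      unfolding E_ft hardy_fourier_transform[OF assms] using K by (simp add: c_def)
    finally show "(\<integral>x. (g x - c * E x) * exp (\<i> * of_real (inner v x)) \<partial>lebesgue) = 0" .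
  qed
  then show ?thesis by (intro exI[of _ c]) (simp add: E_def)
qed

section \<open>The two-sided quaternion transform\<close>

text \<open>A continuous algebra homomorphism passes through the exponential series. Applied to the
  two embeddings of the complex numbers that send \<open>\<i>\<close> to \<open>quat_i\<close> or
  \<open>quat_j\<close>, it evaluates the kernel exponentials.\<close>

lemma exp_algebra_hom:
  fixes E :: "'a::{real_normed_algebra_1, banach} \<Rightarrow> 'b::{real_normed_algebra_1, banach}"
  assumes "bounded_linear E" "E 1 = 1" and mult: "\<And>x y. E (x * y) = E x * E y"
  shows "exp (E x) = E (exp x)"
proof -
  interpret bounded_linear E by fact
  have "E (x ^ n) = E x ^ n" for n
    using assms(2) by (induction n) (auto simp: mult)
  then have "(\<lambda>n. E x ^ n /\<^sub>R fact n) sums E (exp x)"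
    using sums[OF exp_converges[of x]] by (simp add: scaleR)
  then show ?thesis
    using exp_converges[of "E x"] by (rule sums_unique2[symmetric])
qed

lemma quat_of_real: "(of_real r :: quat) = Quat r 0 0 0"
  by (simp add: of_real_def scaleR_quat_def one_quat_def)

lemma exp_quat_i: "exp (- (quat_i * of_real t)) = Quat (cos t) (- sin t) 0 0"
proof -
  define E where "E = (\<lambda>z. Quat (Re z) (Im z) 0 0)"
  have "bounded_linear E"
    unfolding linear_conv_bounded_linear[symmetric] E_def
    by (intro linearI) (auto simp: plus_quat_def scaleR_quat_def)
  then have "exp (E (- \<i> * of_real t)) = E (exp (- \<i> * of_real t))"
    by (rule exp_algebra_hom) (auto simp: E_def one_quat_def times_quat_def algebra_simps)
  moreover have "E (- \<i> * of_real t) = - (quat_i * of_real t)"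
    by (simp add: E_def quat_of_real quat_i_def times_quat_def uminus_quat_def)
  ultimately show ?thesis by (simp add: E_def Re_exp Im_exp)
qed

lemma exp_quat_j: "exp (- (quat_j * of_real t)) = Quat (cos t) 0 (- sin t) 0"
proof -
  define E where "E = (\<lambda>z. Quat (Re z) 0 (Im z) 0)"
  have "bounded_linear E"
    unfolding linear_conv_bounded_linear[symmetric] E_def
    by (intro linearI) (auto simp: plus_quat_def scaleR_quat_def)
  then have "exp (E (- \<i> * of_real t)) = E (exp (- \<i> * of_real t))"
    by (rule exp_algebra_hom) (auto simp: E_def one_quat_def times_quat_def algebra_simps)
  moreover have "E (- \<i> * of_real t) = - (quat_j * of_real t)"
    by (simp add: E_def quat_of_real quat_j_def times_quat_def uminus_quat_def)
  ultimately show ?thesis by (simp add: E_def Re_exp Im_exp)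
qed

text \<open>Up to identification with \<open>\<complex>\<close>, \<open>quat_split (\<plusminus>1) p\<close> is the component \<open>p \<plusminus> i p j\<close>. On it, right
  multiplication by \<open>j\<close> acts as \<open>\<minusplus>1\<close> times left multiplication by \<open>i\<close>, so both exponentials of the
  two-sided kernel become scalars.\<close>

definition quat_split :: "real \<Rightarrow> quat \<Rightarrow> complex" where
  "quat_split s p = Complex (qRe p + s * qK p) (qI p - s * qJ p)"

lemma bounded_linear_quat_split: "bounded_linear (quat_split s)"
  unfolding linear_conv_bounded_linear[symmetric] quat_split_def
  by (intro linearI) (auto simp: plus_quat_def scaleR_quat_def complex_eq_iff algebra_simps)

text \<open>This is the parallelogram law: the mixed terms for the two signs cancel.\<close>

lemma norm_quat_split: "(norm (quat_split 1 p))\<^sup>2 + (norm (quat_split (-1) p))\<^sup>2 = 2 * (norm p)\<^sup>2"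
  unfolding cmod_power2
  by (simp add: quat_split_def norm_quat_def) (simp add: power2_eq_square algebra_simps)

lemma norm_quat_split_le:
  assumes "s \<in> {1, -1}"
  shows "norm (quat_split s p) \<le> 2 * norm p"
proof (rule power2_le_imp_le)
  have "(norm (quat_split s p))\<^sup>2 \<le> (norm (quat_split 1 p))\<^sup>2 + (norm (quat_split (-1) p))\<^sup>2"
    using assms by auto
  also have "\<dots> \<le> (2 * norm p)\<^sup>2" by (simp add: norm_quat_split power_mult_distrib)
  finally show "(norm (quat_split s p))\<^sup>2 \<le> (2 * norm p)\<^sup>2" .
qed simp

lemma quat_split_eqI:
  assumes "quat_split 1 p = quat_split 1 q" "quat_split (-1) p = quat_split (-1) q"
  shows "p = q"
  using assms by (auto simp: quat_split_def quat_eq_iff)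

text \<open>The witness consists of half sums and half differences. It lets two complex constants,
  one per component, be merged into one quaternion.\<close>

lemma quat_split_surj: "\<exists>p. quat_split 1 p = a \<and> quat_split (-1) p = b"
  by (rule exI[of _ "Quat ((Re a + Re b) / 2) ((Im a + Im b) / 2) ((Im b - Im a) / 2) ((Re a - Re b) / 2)"])
    (simp add: quat_split_def complex_eq_iff field_simps)

lemma quat_split_mult_of_real: "quat_split s (p * of_real r) = quat_split s p * of_real r"
  by (simp add: quat_split_def quat_of_real times_quat_def complex_eq_iff algebra_simps)

text \<open>The left factor contributes the phase \<open>- a\<close>. The right one contributes
  \<open>s * b\<close>, since right multiplication by \<open>quat_j\<close> becomes multiplication
  by \<open>- s * \<i>\<close>.\<close>

lemma quat_split_kernel:
  assumes "s \<in> {1, -1}"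
  shows "quat_split s (exp (- (quat_i * of_real a)) * p * exp (- (quat_j * of_real b)))
    = quat_split s p * exp (\<i> * of_real (s * b - a))"
  unfolding exp_quat_i exp_quat_j using assms
  by (auto simp: quat_split_def times_quat_def complex_eq_iff Re_exp Im_exp
      cos_diff sin_diff cos_add sin_add algebra_simps)

text \<open>This is \<open>2 * pi\<close> times an isometry when \<open>s\<close> is 1 or -1, so
  Gaussian bounds in the two frequency variables correspond.\<close>

definition split_freq :: "real \<Rightarrow> real^2 \<Rightarrow> real^2" where
  "split_freq s \<xi> = (\<chi> i. if i = 1 then - 2 * pi * \<xi>$1 else s * 2 * pi * \<xi>$2)"

lemma norm_split_freq:
  assumes "s \<in> {1, -1}"
  shows "(norm (split_freq s \<xi>))\<^sup>2 = 4 * pi\<^sup>2 * (norm \<xi>)\<^sup>2"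
  unfolding power2_norm_eq_inner inner_vec_def sum_2 split_freq_def
  using assms by (auto simp: power2_eq_square algebra_simps)

lemma split_freq_surj:
  assumes "s \<in> {1, -1}"
  shows "\<exists>\<xi>. split_freq s \<xi> = v"
  using assms
  by (intro exI[of _ "\<chi> i. if i = 1 then - v$1 / (2 * pi) else s * v$2 / (2 * pi)"])
    (auto simp: split_freq_def vec_eq_iff forall_2)

text \<open>The bounded linear map \<open>quat_split s\<close> commutes with the integral once the
  integrand is known to be integrable. That follows from the kernel factors having norm at most
  1.\<close>

lemma quat_split_qft:
  assumes f: "integrable lebesgue f" and s: "s \<in> {1, -1}"
  shows "quat_split s (qft f \<xi>)
    = (\<integral>x. quat_split s (f x) * exp (\<i> * of_real (inner (split_freq s \<xi>) x)) \<partial>lebesgue)"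
proof -
  \<comment> \<open>With real trigonometric coefficients and constant quaternions, measurability of
    the kernel reduces to that of sine and cosine.\<close>
  have exps: "exp (- (quat_i * of_real t)) = cos t *\<^sub>R 1 - sin t *\<^sub>R quat_i"
    "exp (- (quat_j * of_real t)) = cos t *\<^sub>R 1 - sin t *\<^sub>R quat_j" for t
    unfolding exp_quat_i exp_quat_j
    by (simp_all add: quat_i_def quat_j_def one_quat_def scaleR_quat_def minus_quat_def)
  have norm_exps: "norm (exp (- (quat_i * of_real t))) \<le> 1" "norm (exp (- (quat_j * of_real t))) \<le> 1" for t
    by (simp_all add: exp_quat_i exp_quat_j norm_quat_def)
  have "integrable lebesgue (\<lambda>x. exp (- (quat_i * of_real (2 * pi * \<xi>$1 * x$1))) * f x *
      exp (- (quat_j * of_real (2 * pi * \<xi>$2 * x$2))))"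
  proof (rule Bochner_Integration.integrable_bound[OF f])
    show "(\<lambda>x. exp (- (quat_i * of_real (2 * pi * \<xi>$1 * x$1))) * f x *
        exp (- (quat_j * of_real (2 * pi * \<xi>$2 * x$2)))) \<in> borel_measurable lebesgue"
      unfolding exps
      by (intro borel_measurable_times borel_measurable_integrable[OF f] lebesgue_borel_measurable) measurable
    show "AE x in lebesgue. norm (exp (- (quat_i * of_real (2 * pi * \<xi>$1 * x$1))) * f x *
        exp (- (quat_j * of_real (2 * pi * \<xi>$2 * x$2)))) \<le> norm (f x)"
    proof (intro AE_I2)
      fix x :: "real^2"
      have "norm (exp (- (quat_i * of_real (2 * pi * \<xi>$1 * x$1))) * f x *
          exp (- (quat_j * of_real (2 * pi * \<xi>$2 * x$2)))) \<le> 1 * norm (f x) * 1"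
        by (intro order_trans[OF norm_mult_ineq] mult_mono norm_exps) auto
      then show "norm (exp (- (quat_i * of_real (2 * pi * \<xi>$1 * x$1))) * f x *
          exp (- (quat_j * of_real (2 * pi * \<xi>$2 * x$2)))) \<le> norm (f x)" by simp
    qed
  qed
  then have "quat_split s (qft f \<xi>) = (\<integral>x. quat_split s (exp (- (quat_i * of_real (2 * pi * \<xi>$1 * x$1))) * f x *
      exp (- (quat_j * of_real (2 * pi * \<xi>$2 * x$2)))) \<partial>lebesgue)"
    unfolding qft_def by (rule integral_bounded_linear[OF bounded_linear_quat_split, symmetric])
  moreover have "s * (2 * pi * \<xi>$2 * x$2) - 2 * pi * \<xi>$1 * x$1 = inner (split_freq s \<xi>) x" for x
    by (simp add: split_freq_def inner_vec_def sum_2)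
  ultimately show ?thesis by (simp only: quat_split_kernel[OF s])
qed

section \<open>The critical exponent for the quaternion transform\<close>

lemma gauss_bounded_mono:
  assumes "gauss_bounded \<gamma> g" "\<gamma>' \<le> \<gamma>"
  shows "gauss_bounded \<gamma>' g"
proof -
  obtain C where C: "C > 0" "\<And>x. norm (g x) < C * exp (- \<gamma> * (norm x)\<^sup>2)"
    using assms(1) by (auto simp: gauss_bounded_def)
  have "norm (g x) < C * exp (- \<gamma>' * (norm x)\<^sup>2)" for x
  proof -
    have "C * exp (- \<gamma> * (norm x)\<^sup>2) \<le> C * exp (- \<gamma>' * (norm x)\<^sup>2)"
      using C(1) assms(2) by (simp add: mult_right_mono)
    then show ?thesis using C(2)[of x] by linarith
  qed
  then show ?thesis using C(1) by (auto simp: gauss_bounded_def)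
qed

text \<open>Both complex components satisfy the classical theorem: with
  \<open>v = split_freq s \<xi>\<close>, the exponent
  \<open>(norm v)\<^sup>2 / (4 * \<alpha>)\<close> equals
  \<open>(pi\<^sup>2 / \<alpha>) * (norm \<xi>)\<^sup>2\<close>.\<close>

lemma qft_hardy_critical:
  assumes \<alpha>: "\<alpha> > 0" and f: "integrable lebesgue f"
    and f_le: "gauss_bounded \<alpha> f" and qft_le: "gauss_bounded (pi\<^sup>2 / \<alpha>) (qft f)"
  shows "\<exists>c. AE x in lebesgue. f x = c * of_real (exp (- \<alpha> * (norm x)\<^sup>2))"
proof -
  obtain C where C: "\<And>x. norm (f x) < C * exp (- \<alpha> * (norm x)\<^sup>2)"
    using f_le by (auto simp: gauss_bounded_def)
  obtain C' where C': "\<And>\<xi>. norm (qft f \<xi>) < C' * exp (- (pi\<^sup>2 / \<alpha>) * (norm \<xi>)\<^sup>2)"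
    using qft_le by (auto simp: gauss_bounded_def)
  have part: "\<exists>c. AE x in lebesgue. quat_split s (f x) = c * of_real (exp (- \<alpha> * (norm x)\<^sup>2))"
    if s: "s \<in> {1, -1}" for s
  proof (rule hardy_critical[OF \<alpha>])
    show "integrable lebesgue (\<lambda>x. quat_split s (f x))"
      by (rule integrable_bounded_linear[OF bounded_linear_quat_split f])
    show "norm (quat_split s (f x)) \<le> 2 * C * exp (- \<alpha> * (norm x)\<^sup>2)" for x
      using norm_quat_split_le[OF s, of "f x"] C[of x] by simp
    fix v
    obtain \<xi> where v: "v = split_freq s \<xi>" using split_freq_surj[OF s] by metis
    have "norm (quat_split s (qft f \<xi>)) \<le> 2 * C' * exp (- (pi\<^sup>2 / \<alpha>) * (norm \<xi>)\<^sup>2)"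
      using norm_quat_split_le[OF s, of "qft f \<xi>"] C'[of \<xi>] by simp
    then show "norm (\<integral>x. quat_split s (f x) * exp (\<i> * of_real (inner v x)) \<partial>lebesgue)
        \<le> 2 * C' * exp (- (norm v)\<^sup>2 / (4 * \<alpha>))"
      unfolding v quat_split_qft[OF f s] norm_split_freq[OF s] by simp
  qed
  obtain a where a: "AE x in lebesgue. quat_split 1 (f x) = a * of_real (exp (- \<alpha> * (norm x)\<^sup>2))"
    using part[of 1] by auto
  obtain b where b: "AE x in lebesgue. quat_split (-1) (f x) = b * of_real (exp (- \<alpha> * (norm x)\<^sup>2))"
    using part[of "-1"] by auto
  obtain c where c: "quat_split 1 c = a" "quat_split (-1) c = b"
    using quat_split_surj by blast
  have "AE x in lebesgue. f x = c * of_real (exp (- \<alpha> * (norm x)\<^sup>2))"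
    using a b by eventually_elim (intro quat_split_eqI, simp_all only: quat_split_mult_of_real c)
  then show ?thesis ..
qed

section \<open>Linear independence of Gaussians\<close>

lemma AE_lebesgue_zero_imp_zero:
  fixes h :: "'a::euclidean_space \<Rightarrow> 'b::real_normed_vector"
  assumes "continuous_on UNIV h" "AE x in lebesgue. h x = 0"
  shows "h x = 0"
proof -
  obtain N where "{x \<in> space lebesgue. h x \<noteq> 0} \<subseteq> N" "N \<in> null_sets lebesgue"
    using assms(2) by (auto simp: eventually_ae_filter)
  then have "negligible {x. h x \<noteq> 0}"
    using negligible_subset[of N] by (simp add: negligible_iff_null_sets)
  moreover have "open {x. h x \<noteq> 0}"
    using assms(1) by (intro open_Collect_neq) auto
  ultimately have "{x. h x \<noteq> 0} = {}" using open_not_negligible by blast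
  then show ?thesis by blast
qed

text \<open>After multiplication by \<open>exp (m * t)\<close>, with \<open>m\<close> the least
  exponent having a nonzero coefficient, every other term decays. The limit at infinity is then
  \<open>c m\<close>, a contradiction.\<close>

lemma exp_combination_zero:
  fixes c :: "real \<Rightarrow> 'b::real_normed_vector"
  assumes fin: "finite \<Gamma>" and zero: "\<And>t. t \<ge> 0 \<Longrightarrow> (\<Sum>\<gamma>\<in>\<Gamma>. exp (- \<gamma> * t) *\<^sub>R c \<gamma>) = 0"
    and "\<gamma> \<in> \<Gamma>"
  shows "c \<gamma> = 0"
proof (rule ccontr)
  assume "c \<gamma> \<noteq> 0"
  define \<Delta> m where "\<Delta> = {\<gamma> \<in> \<Gamma>. c \<gamma> \<noteq> 0}" and "m = Min \<Delta>"
  have \<Delta>: "finite \<Delta>" "\<Delta> \<noteq> {}" using fin \<open>c \<gamma> \<noteq> 0\<close> \<open>\<gamma> \<in> \<Gamma>\<close> by (auto simp: \<Delta>_def)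
  then have m: "m \<in> \<Delta>" "\<And>\<gamma>. \<gamma> \<in> \<Delta> \<Longrightarrow> m \<le> \<gamma>" by (auto simp: m_def)
  have "((\<lambda>t. \<Sum>\<gamma>\<in>\<Delta>. exp ((m - \<gamma>) * t) *\<^sub>R c \<gamma>) \<longlongrightarrow> (\<Sum>\<gamma>\<in>\<Delta>. (if \<gamma> = m then 1 else 0) *\<^sub>R c \<gamma>)) at_top"
  proof (intro tendsto_sum tendsto_scaleR tendsto_const)
    fix \<gamma> assume "\<gamma> \<in> \<Delta>"
    show "((\<lambda>t. exp ((m - \<gamma>) * t)) \<longlongrightarrow> (if \<gamma> = m then 1 else 0)) at_top"
    proof (cases "\<gamma> = m")
      case False
      then have "m - \<gamma> < 0" using m(2)[OF \<open>\<gamma> \<in> \<Delta>\<close>] by simp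
      then have "((\<lambda>t. exp ((m - \<gamma>) * t)) \<longlongrightarrow> 0) at_top" by real_asymp
      then show ?thesis using False by simp
    qed simp
  qed
  moreover have "(\<Sum>\<gamma>\<in>\<Delta>. (if \<gamma> = m then 1 else 0) *\<^sub>R c \<gamma>) = c m"
    using \<Delta> m by (simp add: if_distrib[of "\<lambda>r. r *\<^sub>R _"] sum.delta cong: if_cong)
  moreover have "eventually (\<lambda>t. (\<Sum>\<gamma>\<in>\<Delta>. exp ((m - \<gamma>) * t) *\<^sub>R c \<gamma>) = 0) at_top"
    using eventually_ge_at_top[of 0]
  proof eventually_elim
    case (elim t)
    have "(\<Sum>\<gamma>\<in>\<Delta>. exp ((m - \<gamma>) * t) *\<^sub>R c \<gamma>) = exp (m * t) *\<^sub>R (\<Sum>\<gamma>\<in>\<Delta>. exp (- \<gamma> * t) *\<^sub>R c \<gamma>)"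
      by (simp add: scaleR_sum_right mult_exp_exp left_diff_distrib)
    also have "(\<Sum>\<gamma>\<in>\<Delta>. exp (- \<gamma> * t) *\<^sub>R c \<gamma>) = (\<Sum>\<gamma>\<in>\<Gamma>. exp (- \<gamma> * t) *\<^sub>R c \<gamma>)"
      using fin by (intro sum.mono_neutral_left) (auto simp: \<Delta>_def)
    finally show ?case using zero[OF elim] by simp
  qed
  ultimately have "((\<lambda>t. 0) \<longlongrightarrow> c m) (at_top :: real filter)"
    using tendsto_cong by fastforce
  then have "c m = 0" by (simp add: tendsto_const_iff)
  then show False using m(1) by (simp add: \<Delta>_def)
qed

definition quat_gaussian :: "real \<Rightarrow> real^2 \<Rightarrow> quat" where
  "quat_gaussian \<gamma> x = of_real (exp (- \<gamma> * (norm x)\<^sup>2))"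

lemma ex_norm_power2_eq:
  assumes "t \<ge> 0"
  shows "\<exists>x::real^2. (norm x)\<^sup>2 = t"
  using assms by (intro exI[of _ "sqrt t *\<^sub>R axis 1 1"]) (simp add: norm_axis_1)

lemma inj_quat_gaussian: "inj quat_gaussian"
proof (rule injI)
  fix a b assume eq: "quat_gaussian a = quat_gaussian b"
  obtain x :: "real^2" where "(norm x)\<^sup>2 = 1" using ex_norm_power2_eq[of 1] by auto
  then show "a = b" using fun_cong[OF eq, of x] by (simp add: quat_gaussian_def)
qed

text \<open>Continuity removes the exceptional null set. As the squared norm takes every nonnegative
  value, a combination of exponentials on the half-line remains.\<close>

lemma quat_gaussian_combination_zero:
  fixes c :: "(real^2 \<Rightarrow> quat) \<Rightarrow> quat"
  assumes T: "finite T" "T \<subseteq> range quat_gaussian"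
    and zero: "AE x in lebesgue. (\<Sum>g\<in>T. qRe (g x) *\<^sub>R c g) = 0" and g: "g \<in> T"
  shows "c g = 0"
proof -
  obtain \<Gamma> where \<Gamma>: "finite \<Gamma>" "T = quat_gaussian ` \<Gamma>"
    using finite_subset_image[OF T] by blast
  have sum: "(\<Sum>g\<in>T. qRe (g x) *\<^sub>R c g) = (\<Sum>\<gamma>\<in>\<Gamma>. exp (- \<gamma> * (norm x)\<^sup>2) *\<^sub>R c (quat_gaussian \<gamma>))" for x
    unfolding \<Gamma>(2) using inj_quat_gaussian
    by (subst sum.reindex) (auto simp: inj_on_def quat_gaussian_def quat_of_real)
  have all: "(\<Sum>\<gamma>\<in>\<Gamma>. exp (- \<gamma> * (norm x)\<^sup>2) *\<^sub>R c (quat_gaussian \<gamma>)) = 0" for x :: "real^2"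
    using zero unfolding sum
    by (intro AE_lebesgue_zero_imp_zero[where h = "\<lambda>x::real^2. \<Sum>\<gamma>\<in>\<Gamma>. exp (- \<gamma> * (norm x)\<^sup>2) *\<^sub>R c (quat_gaussian \<gamma>)"])
      (auto intro!: continuous_intros)
  have "(\<Sum>\<gamma>\<in>\<Gamma>. exp (- \<gamma> * t) *\<^sub>R c (quat_gaussian \<gamma>)) = 0" if "t \<ge> 0" for t
    using ex_norm_power2_eq[OF that] all by auto
  then have "c (quat_gaussian \<gamma>) = 0" if "\<gamma> \<in> \<Gamma>" for \<gamma>
    using exp_combination_zero[OF \<Gamma>(1), of "\<lambda>\<gamma>. c (quat_gaussian \<gamma>)"] that by blast
  then show ?thesis using g \<Gamma>(2) by auto
qed

text \<open>The Gaussians are real-valued and commute with all coefficients, so left and right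
  combinations reduce to the same real-scalar form.\<close>

lemma independent_quat_gaussians:
  assumes "S \<subseteq> range quat_gaussian"
  shows "left_independent S" "right_independent S"
proof -
  have comm: "c * g x = qRe (g x) *\<^sub>R c" "g x * c = qRe (g x) *\<^sub>R c" if "g \<in> S" for g x c
    using assms that by (auto simp: quat_gaussian_def quat_of_real times_quat_def scaleR_quat_def)
  have left: "(\<Sum>g\<in>T. c g * g x) = (\<Sum>g\<in>T. qRe (g x) *\<^sub>R c g)"
    and right: "(\<Sum>g\<in>T. g x * c g) = (\<Sum>g\<in>T. qRe (g x) *\<^sub>R c g)" if "T \<subseteq> S" for T c x
    using that by (auto intro!: sum.cong comm)
  show "left_independent S"
    unfolding left_independent_def
  proof (intro allI impI ballI)
    fix T and c :: "(real^2 \<Rightarrow> quat) \<Rightarrow> quat" and g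
    assume T: "finite T \<and> T \<subseteq> S \<and> (AE x in lebesgue. (\<Sum>g\<in>T. c g * g x) = 0)" and "g \<in> T"
    then show "c g = 0"
      using quat_gaussian_combination_zero[of T c g] left[where T = T and c = c] subset_trans[OF _ assms] by simp
  qed
  show "right_independent S"
    unfolding right_independent_def
  proof (intro allI impI ballI)
    fix T and c :: "(real^2 \<Rightarrow> quat) \<Rightarrow> quat" and g
    assume T: "finite T \<and> T \<subseteq> S \<and> (AE x in lebesgue. (\<Sum>g\<in>T. g x * c g) = 0)" and "g \<in> T"
    then show "c g = 0"
      using quat_gaussian_combination_zero[of T c g] right[where T = T and c = c] subset_trans[OF _ assms] by simp
  qed
qed

section \<open>Bounds for Gaussians and their transforms\<close>

lemma integrable_quat_gaussian:
  assumes "\<gamma> > 0"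
  shows "integrable lebesgue (quat_gaussian \<gamma>)"
proof -
  have "integrable lebesgue (\<lambda>x::real^2. exp (- \<gamma> * (norm x)\<^sup>2))"
    using integrable_gaussian[OF assms] by (subst integrable_completion) auto
  then show ?thesis
    unfolding quat_gaussian_def[abs_def] by (rule integrable_of_real)
qed

text \<open>Both complex components have this same modulus, and \<open>norm_quat_split\<close>
  recovers the quaternion norm from them.\<close>

lemma norm_qft_quat_gaussian:
  assumes \<gamma>: "\<gamma> > 0"
  shows "norm (qft (quat_gaussian \<gamma>) \<xi>)
    = (\<integral>x. exp (- \<gamma> * (norm (x::real^2))\<^sup>2) \<partial>lborel) * exp (- (pi\<^sup>2 / \<gamma>) * (norm \<xi>)\<^sup>2)"
    (is "_ = ?K * ?e")
proof -
  have "norm (quat_split s (qft (quat_gaussian \<gamma>) \<xi>)) = ?K * ?e" if s: "s \<in> {1, -1}" for s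
  proof -
    have "quat_split s (qft (quat_gaussian \<gamma>) \<xi>) =
        (\<integral>x. complex_of_real (exp (- \<gamma> * (norm x)\<^sup>2)) * exp (\<i> * of_real (inner (split_freq s \<xi>) x)) \<partial>lebesgue)"
      unfolding quat_split_qft[OF integrable_quat_gaussian[OF \<gamma>] s]
      by (simp add: quat_gaussian_def quat_split_def quat_of_real complex_of_real_def)
    also have "\<dots> = complex_of_real (?K * exp (- (norm (split_freq s \<xi>))\<^sup>2 / (4 * \<gamma>)))"
      unfolding fourier_gaussian[OF \<gamma>, symmetric] by (rule integral_completion) measurable
    finally show ?thesis
      using less_imp_le[OF gaussian_integral_pos[OF \<gamma>, where 'a="real^2"]]
      by (simp only: norm_of_real norm_split_freq[OF s] abs_mult) simp
  qed
  then have "2 * (norm (qft (quat_gaussian \<gamma>) \<xi>))\<^sup>2 = 2 * (?K * ?e)\<^sup>2"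
    using norm_quat_split[of "qft (quat_gaussian \<gamma>) \<xi>"] by simp
  moreover have "?K * ?e \<ge> 0"
    using gaussian_integral_pos[OF \<gamma>, where 'a="real^2"] by simp
  ultimately show ?thesis
    using power2_eq_imp_eq[of "norm (qft (quat_gaussian \<gamma>) \<xi>)" "?K * ?e"] by simp
qed

lemma gauss_bounded_quat_gaussian:
  assumes "\<gamma> > 0"
  shows "gauss_bounded \<gamma> (quat_gaussian \<gamma>)" "gauss_bounded (pi\<^sup>2 / \<gamma>) (qft (quat_gaussian \<gamma>))"
proof -
  show "gauss_bounded \<gamma> (quat_gaussian \<gamma>)"
    \<comment> \<open>The strict bound calls for a constant above the attained one: 2 in place of 1
      here, and the Gaussian integral plus 1 for the transform.\<close>
    unfolding gauss_bounded_def by (intro exI[of _ 2]) (simp add: quat_gaussian_def)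
  show "gauss_bounded (pi\<^sup>2 / \<gamma>) (qft (quat_gaussian \<gamma>))"
    unfolding gauss_bounded_def norm_qft_quat_gaussian[OF assms]
    using gaussian_integral_pos[OF assms, where 'a="real^2"]
    by (intro exI[of _ "(\<integral>x. exp (- \<gamma> * (norm (x::real^2))\<^sup>2) \<partial>lborel) + 1"]) auto
qed

section \<open>The three regimes of the product of the exponents\<close>

theorem corollary4p4:
  fixes \<alpha> \<beta> :: real
  assumes "\<alpha> > 0" and "\<beta> > 0"
  shows "(\<alpha> * \<beta> > pi\<^sup>2 \<longrightarrow>
           (\<forall>f :: real^2 \<Rightarrow> quat.
              integrable lebesgue f \<and> gauss_bounded \<alpha> f \<and> gauss_bounded \<beta> (qft f) \<longrightarrow>
              (AE x in lebesgue. f x = 0)))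
       \<and> (\<alpha> * \<beta> = pi\<^sup>2 \<longrightarrow>
           (\<forall>f :: real^2 \<Rightarrow> quat.
              integrable lebesgue f \<and> gauss_bounded \<alpha> f \<and> gauss_bounded \<beta> (qft f) \<longrightarrow>
              (\<exists>c :: quat. AE x in lebesgue. f x = c * of_real (exp (- \<alpha> * (norm x)\<^sup>2)))))
       \<and> (\<alpha> * \<beta> < pi\<^sup>2 \<longrightarrow>
           (\<exists>S :: (real^2 \<Rightarrow> quat) set.
              infinite S \<and> left_independent S \<and> right_independent S \<and>
              (\<forall>f\<in>S. integrable lebesgue f \<and> gauss_bounded \<alpha> f \<and> gauss_bounded \<beta> (qft f))))"
proof (intro conjI impI allI)
  fix f :: "real^2 \<Rightarrow> quat"
  assume less: "pi\<^sup>2 < \<alpha> * \<beta>"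
    and f: "integrable lebesgue f \<and> gauss_bounded \<alpha> f \<and> gauss_bounded \<beta> (qft f)"
  \<comment> \<open>\<open>\<alpha>'\<close> is the exponent critical for \<open>\<beta>\<close>.
    Weakening one bound at a time makes \<open>f\<close> critical for \<open>\<alpha>\<close> and
    for \<open>\<alpha>'\<close>, hence a multiple of two different Gaussians.\<close>
  define \<alpha>' where "\<alpha>' = pi\<^sup>2 / \<beta>"
  have \<alpha>': "\<alpha>' > 0" "\<alpha>' < \<alpha>" "pi\<^sup>2 / \<alpha>' = \<beta>" "pi\<^sup>2 / \<alpha> \<le> \<beta>"
    using assms less by (auto simp: \<alpha>'_def field_simps)
  have f': "gauss_bounded \<alpha>' f" "gauss_bounded (pi\<^sup>2 / \<alpha>) (qft f)"
    using f \<alpha>' by (auto intro: gauss_bounded_mono)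
  obtain a where a: "AE x in lebesgue. f x = a * of_real (exp (- \<alpha> * (norm x)\<^sup>2))"
    using qft_hardy_critical[OF assms(1)] f f' by blast
  obtain b where b: "AE x in lebesgue. f x = b * of_real (exp (- \<alpha>' * (norm x)\<^sup>2))"
    using qft_hardy_critical[OF \<alpha>'(1)] f f' \<alpha>' by auto
  have "AE x :: real^2 in lebesgue. exp (- \<alpha> * (norm x)\<^sup>2) *\<^sub>R a - exp (- \<alpha>' * (norm x)\<^sup>2) *\<^sub>R b = 0"
    using a b by eventually_elim (simp add: of_real_def)
  then have eq: "exp (- \<alpha> * (norm x)\<^sup>2) *\<^sub>R a - exp (- \<alpha>' * (norm x)\<^sup>2) *\<^sub>R b = 0" for x :: "real^2"
    by (intro AE_lebesgue_zero_imp_zero[where h = "\<lambda>x::real^2. exp (- \<alpha> * (norm x)\<^sup>2) *\<^sub>R a - exp (- \<alpha>' * (norm x)\<^sup>2) *\<^sub>R b"])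
      (auto intro!: continuous_intros)
  \<comment> \<open>The origin identifies the two coefficients; at a unit vector the Gaussians
    differ, so the common coefficient is 0.\<close>
  have ab: "a = b" using eq[of 0] by simp
  obtain x :: "real^2" where x: "(norm x)\<^sup>2 = 1" using ex_norm_power2_eq[of 1] by auto
  have "(exp (- \<alpha>) - exp (- \<alpha>')) *\<^sub>R a = 0" using eq[of x] ab x by (simp add: scaleR_diff_left)
  then have "a = 0" using \<alpha>'(2) by simp
  then show "AE x in lebesgue. f x = 0" using a by simp
next
  fix f :: "real^2 \<Rightarrow> quat"
  assume "\<alpha> * \<beta> = pi\<^sup>2"
    and f: "integrable lebesgue f \<and> gauss_bounded \<alpha> f \<and> gauss_bounded \<beta> (qft f)"
  then have "\<beta> = pi\<^sup>2 / \<alpha>" using assms by (simp add: field_simps)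
  then show "\<exists>c. AE x in lebesgue. f x = c * of_real (exp (- \<alpha> * (norm x)\<^sup>2))"
    using qft_hardy_critical[OF assms(1)] f by blast
next
  assume less: "\<alpha> * \<beta> < pi\<^sup>2"
  \<comment> \<open>Exponents above \<open>\<alpha>\<close> give the bound on the function, and
    those below \<open>pi\<^sup>2 / \<beta>\<close> the bound on its transform.\<close>
  define S where "S = quat_gaussian ` {\<alpha><..<pi\<^sup>2 / \<beta>}"
  have "\<alpha> < pi\<^sup>2 / \<beta>" using less assms by (simp add: field_simps)
  then have "infinite S"
    unfolding S_def using inj_quat_gaussian
    by (subst finite_image_iff) (auto intro: inj_on_subset)
  moreover have "left_independent S" "right_independent S"
    by (intro independent_quat_gaussians; auto simp: S_def)+
  moreover have "integrable lebesgue f \<and> gauss_bounded \<alpha> f \<and> gauss_bounded \<beta> (qft f)" if f: "f \<in> S" for f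
  proof -
    obtain \<gamma> where \<gamma>: "f = quat_gaussian \<gamma>" "\<alpha> < \<gamma>" "\<gamma> < pi\<^sup>2 / \<beta>"
      using f by (auto simp: S_def)
    then have "\<gamma> > 0" "\<beta> \<le> pi\<^sup>2 / \<gamma>" using assms by (auto simp: field_simps)
    then show ?thesis
      unfolding \<gamma>(1) using \<gamma>(2) integrable_quat_gaussian gauss_bounded_mono
        gauss_bounded_quat_gaussian less_imp_le by metis
  qed
  ultimately show "\<exists>S :: (real^2 \<Rightarrow> quat) set. infinite S \<and> left_independent S \<and> right_independent S \<and>
      (\<forall>f\<in>S. integrable lebesgue f \<and> gauss_bounded \<alpha> f \<and> gauss_bounded \<beta> (qft f))"
    by blast
qed

end
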